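(* Let $\mathfrak{g}=(\mathfrak{g}_{-1}\xrightarrow{l_1}\mathfrak{g}_0,\ l_2=l_2^0+l_2^1,\ l_3)$ be a $2$-term $L_\infty$-algebra and let $E=\mathfrak{g}_{-1}^*\times(\mathfrak{g}_0^*\oplus\mathfrak{g}_0)\to\mathfrak{g}_{-1}^*$ be the Courant algebroid associated to it. Restricting the $2$-term $L_\infty$-algebra of $E$ to the linear functions $\mathfrak{g}_{-1}\subset C^\infty(\mathfrak{g}_{-1}^* )$ in degree $-1$ and to the sections $\mathfrak{g}_0\oplus(\mathfrak{g}_{-1}\otimes\mathfrak{g}_0^* )\subset\Gamma(E)$ in degree $0$ gives a $2$-term $L_\infty$-algebra $$\tilde{\mathfrak{g}}=\big(\mathfrak{g}_{-1}\xrightarrow{\tilde l_1}\mathfrak{g}_0\oplus(\mathfrak{g}_{-1}\otimes\mathfrak{g}_0^* ),\ \tilde l_2=\tilde l_2^0+\tilde l_2^1,\ \tilde l_3\big),$$ whose operations are as follows, for $x,y,x_i\in\mathfrak{g}_0$, $m,n,m_i\in\mathfrak{g}_{-1}$, $\xi,\eta,\xi_i\in\mathfrak{g}_0^*$: $\tilde l_1(m)=l_1(m)-l_2^1(m,\cdot)$; $\tilde l_2^0$ is the skew-symmetric bilinear map determined by $$\tilde l_2^0(x,y)=l_2^0(x,y)+l_3(x,y,\cdot),$$ $$\tilde l_2^0(x,\xi\otimes m)=\xi\otimes l_2^1(x,m)+(l_2^0(x,\cdot)^*\xi)\otimes m-\tfrac12\xi(x)\big(l_1(m)-l_2^1(m,\cdot)\big),$$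 $$\tilde l_2^0(\xi\otimes m,\eta\otimes n)=\langle l_1^*\eta,m\rangle\,\xi\otimes n-\langle l_1^*\xi,n\rangle\,\eta\otimes m;$$ $\tilde l_2^1(x+\xi\otimes m,n)=\tfrac12 l_2^1(x,n)+\tfrac12\langle\xi,l_1(n)\rangle m$; and $$\begin{aligned} &\tilde l_3(x_1+\xi_1\otimes m_1,\,x_2+\xi_2\otimes m_2,\,x_3+\xi_3\otimes m_3)\\ &=-\tfrac12 l_3(x_1,x_2,x_3)-\tfrac12\big(\langle l_2^0(x_1,x_2),\xi_3\rangle m_3+c.p.\big)\\ &\quad-\tfrac14\big(\langle\xi_1,x_2\rangle\langle\xi_3,l_1m_1\rangle m_3-\langle\xi_2,x_1\rangle\langle\xi_3,l_1m_2\rangle m_3+c.p.\big)\\ &\quad-\tfrac14\big(\langle\xi_2,x_3\rangle l_2^1(x_1,m_2)-\langle\xi_3,x_2\rangle l_2^1(x_1,m_3)+c.p.\big). \end{aligned}$$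
   Context: All vector spaces are real and finite-dimensional. A $2$-term $L_\infty$-algebra $(\mathfrak{g}_{-1}\xrightarrow{l_1}\mathfrak{g}_0,l_2=l_2^0+l_2^1,l_3)$ consists of a linear map $l_1:\mathfrak{g}_{-1}\to\mathfrak{g}_0$, maps $l_2^0:\wedge^2\mathfrak{g}_0\to\mathfrak{g}_0$, $l_2^1:\mathfrak{g}_0\otimes\mathfrak{g}_{-1}\to\mathfrak{g}_{-1}$ (with $l_2(m,x)=-l_2(x,m)$, $l_2(m,n)=0$) and $l_3:\wedge^3\mathfrak{g}_0\to\mathfrak{g}_{-1}$, with, for $x,y,z,x_i\in\mathfrak{g}_0$, $m,n\in\mathfrak{g}_{-1}$: $l_1l_2(x,m)=l_2(x,l_1m)$; $l_2(l_1m,n)=l_2(m,l_1n)$; $l_2(l_2(x,y),z)+c.p.+l_1l_3(x,y,z)=0$; $l_2(l_2(x,y),m)+l_2(l_2(y,m),x)+l_2(l_2(m,x),y)+l_3(x,y,l_1m)=0$; $\sum_{\sigma}\mathrm{sgn}(\sigma)l_3(l_2(x_{\sigma(1)},x_{\sigma(2)}),x_{\sigma(3)},x_{\sigma(4)})=\sum_{\tau}\mathrm{sgn}(\tau)l_2(l_3(x_{\tau(1)},x_{\tau(2)},x_{\tau(3)}),x_{\tau(4)})$, $\sigma$ over $(2,2)$- and $\tau$ over $(3,1)$-unshuffles. "$c.p.$" denotes the cyclic permutations of the three arguments (indices $1,2,3$). Notation: $l_1^*:\mathfrak{g}_0^*\to\mathfrak{g}_{-1}^*$, $\langle l_1^*\xi,m\rangle=-\langle\xi,l_1(m)\rangle$;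 $\langle l_2^0(x,\cdot)^*\xi,y\rangle=-\langle\xi,l_2^0(x,y)\rangle$; $l_2^1(m,\cdot)$ and $l_3(x,y,\cdot)$ are elements of $\mathrm{Hom}(\mathfrak{g}_0,\mathfrak{g}_{-1})=\mathfrak{g}_0^*\otimes\mathfrak{g}_{-1}$. Elements of $\mathfrak{g}_{-1}$ are linear functions on the manifold $\mathfrak{g}_{-1}^*$; elements of $\mathfrak{g}_0,\mathfrak{g}_0^*$ are constant sections of $E$; $\xi\otimes m\in\mathfrak{g}_0^*\otimes\mathfrak{g}_{-1}$ (identified with $\mathfrak{g}_{-1}\otimes\mathfrak{g}_0^*$) is the linear section $\alpha\mapsto\langle\alpha,m\rangle\xi$. Courant algebroid: vector bundle $E\to M$ with fibre metric $(\cdot,\cdot)_+$, anchor $\rho:E\to TM$ and Dorfman bracket $\lceil\cdot,\cdot\rceil$ on $\Gamma(E)$ with $\lceil e,e\rceil=\frac12D(e,e)_+$, $\rho(e_1)(e_2,e_3)_+=(\lceil e_1,e_2\rceil,e_3)_++(e_2,\lceil e_1,e_3\rceil)_+$, $\lceil e_1,\lceil e_2,e_3\rceil\rceil=\lceil\lceil e_1,e_2\rceil,e_3\rceil+\lceil e_2,\lceil e_1,e_3\rceil\rceil$, where $(e,Df)_+=\rho(e)f$. The Courant bracket is $[\![e_1,e_2]\!]=\frac12(\lceil e_1,e_2\rceil-\lceil e_2,e_1\rceil)$. The $2$-term $L_\infty$-algebra of $E$ is $C^\infty(M)\oplus\Gamma(E)$ (degrees $-1$ and $0$) with $l_1(f)=Df$,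 $l_2(e_1,e_2)=[\![e_1,e_2]\!]$, $l_2(e,f)=\frac12(e,Df)_+$, $l_3(e_1,e_2,e_3)=-T(e_1,e_2,e_3)$, $T=\frac16([\![e_1,e_2]\!],e_3)_++c.p.$ The Courant algebroid associated to $\mathfrak{g}$: on the graded manifold $T^*[2]\mathfrak{g}^*[1]$ the polynomial functions are generated by $m\in\mathfrak{g}_{-1}$ (degree $0$), $x\in\mathfrak{g}_0$ and $\xi\in\mathfrak{g}_0^*$ (degree $1$), $\alpha\in\mathfrak{g}_{-1}^*$ (degree $2$). The canonical degree $-2$ Poisson bracket has $\{x,\xi\}=\{\xi,x\}=\langle\xi,x\rangle$, $\{m,\alpha\}=-\{\alpha,m\}=\langle\alpha,m\rangle$, other brackets of generators zero, $\{u,vw\}=\{u,v\}w+(-1)^{|u||v|}v\{u,w\}$, $\{u,v\}=-(-1)^{|u||v|}\{v,u\}$. Regard $l_1\in\mathfrak{g}_{-1}^*\otimes\mathfrak{g}_0$, $l_2^0\in\wedge^2\mathfrak{g}_0^*\otimes\mathfrak{g}_0$, $l_2^1\in\mathfrak{g}_0^*\wedge\mathfrak{g}_{-1}^*\otimes\mathfrak{g}_{-1}$, $l_3\in\wedge^3\mathfrak{g}_0^*\otimes\mathfrak{g}_{-1}$ as degree $3$ functions, normalized so that $l_1(m)=\{m,l_1\}$, $l_2^0(x,y)=\{y,\{x,l_2^0\}\}$, $l_2^1(x,m)=\{m,\{x,l_2^1\}\}$, $l_3(x,y,\cdot)=\{y,\{x,l_3\}\}$, and put $\Theta=-(l_1+l_2^0+l_2^1+l_3)$.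 Then $E$ has fibre metric the canonical pairing $(\xi+x,\eta+y)_+=\langle\xi,y\rangle+\langle\eta,x\rangle$, anchor $\rho(e)f=\{\{e,\Theta\},f\}$ and Dorfman bracket $\lceil e_1,e_2\rceil=\{\{e_1,\Theta\},e_2\}$. *)

theory Defs
  imports "HOL-Analysis.Analysis"
begin

section \<open>Linear maps as a type; dual spaces and tensor products\<close>

typedef (overloaded) ('a, 'b) lin = "{f :: 'a::real_vector \<Rightarrow> 'b::real_vector. linear f}"
  morphisms lin_app Lin
  using linear_zero by auto

setup_lifting type_definition_lin

declare [[coercion "lin_app :: ('a::real_vector, 'b::real_vector) lin \<Rightarrow> 'a \<Rightarrow> 'b"]]

instantiation lin :: (real_vector, real_vector) real_vector
begin
lift_definition zero_lin :: "('a, 'b) lin" is "\<lambda>_. 0" by (rule linear_zero)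
lift_definition plus_lin :: "('a, 'b) lin \<Rightarrow> ('a, 'b) lin \<Rightarrow> ('a, 'b) lin"
  is "\<lambda>f g x. f x + g x" by (rule linear_compose_add)
lift_definition minus_lin :: "('a, 'b) lin \<Rightarrow> ('a, 'b) lin \<Rightarrow> ('a, 'b) lin"
  is "\<lambda>f g x. f x - g x" by (rule linear_compose_sub)
lift_definition uminus_lin :: "('a, 'b) lin \<Rightarrow> ('a, 'b) lin"
  is "\<lambda>f x. - f x" by (rule linear_compose_neg)
lift_definition scaleR_lin :: "real \<Rightarrow> ('a, 'b) lin \<Rightarrow> ('a, 'b) lin"
  is "\<lambda>c f x. c *\<^sub>R f x" by (rule linear_compose_scale_right)
instance
  by standard (transfer; simp add: fun_eq_iff algebra_simps)+
end

type_synonym 'a dual = "('a, real) lin"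

text \<open>The space \<open>'x\<^sup>* \<otimes> 'm\<close> is the type \<open>('x, 'm) lin\<close>, with
  \<open>\<xi> \<otimes> m\<close> the map \<open>x \<mapsto> \<langle>\<xi>, x\<rangle> m\<close>.\<close>

lift_definition tens :: "'x::real_vector dual \<Rightarrow> 'm::real_vector \<Rightarrow> ('x, 'm) lin"
  is "\<lambda>\<xi> m x. \<xi> x *\<^sub>R m"
  by (auto simp: linear_iff algebra_simps)

definition is_basis :: "'a::real_vector list \<Rightarrow> bool" where
  "is_basis bs \<longleftrightarrow> distinct bs \<and> independent (set bs) \<and> span (set bs) = UNIV"

definition coord :: "'a::real_vector list \<Rightarrow> nat \<Rightarrow> 'a dual" where
  "coord bs i = Lin (\<lambda>v. representation (set bs) v (bs ! i))"


section \<open>2-term L-infinity algebras\<close>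

text \<open>The four maps are \<open>l\<^sub>1\<close>, \<open>l\<^sub>2\<^sup>0\<close>, \<open>l\<^sub>2\<^sup>1\<close> and \<open>l\<^sub>3\<close>; the bracket of \<open>m\<close> of degree -1 with
  \<open>x\<close> of degree 0, in this order, is \<open>- l21 x m\<close>.\<close>

locale two_term_Linf =
  fixes l1 :: "'m::real_vector \<Rightarrow> 'x::real_vector"
    and l20 :: "'x \<Rightarrow> 'x \<Rightarrow> 'x"
    and l21 :: "'x \<Rightarrow> 'm \<Rightarrow> 'm"
    and l3 :: "'x \<Rightarrow> 'x \<Rightarrow> 'x \<Rightarrow> 'm"
  assumes fin_dim_m: "\<exists>B. finite B \<and> span B = (UNIV :: 'm set)"
    and fin_dim_x: "\<exists>B. finite B \<and> span B = (UNIV :: 'x set)"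
    and linear_l1: "linear l1"
    and bilinear_l20: "bilinear l20"
    and skew_l20: "l20 x y = - l20 y x"
    and bilinear_l21: "bilinear l21"
    and linear_l3: "linear (\<lambda>x. l3 x y z)"
    and skew_l3: "l3 x y z = - l3 y x z" "l3 x y z = - l3 x z y"
    and l1_l2: "l1 (l21 x m) = l20 x (l1 m)"
    and l2_l1: "l21 (l1 m) n = - l21 (l1 n) m"
    and jacobi_000: "l20 (l20 x y) z + l20 (l20 y z) x + l20 (l20 z x) y + l1 (l3 x y z) = 0"
    and jacobi_001: "l21 (l20 x y) m + (- l21 x (l21 y m)) + (- l21 y (- l21 x m)) + l3 x y (l1 m) = 0"
    and jacobi_0000:
      \<comment> \<open>left: the (2,2)-unshuffles; right: the (3,1)-unshuffles\<close>
      "l3 (l20 x1 x2) x3 x4 - l3 (l20 x1 x3) x2 x4 + l3 (l20 x1 x4) x2 x3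
         + l3 (l20 x2 x3) x1 x4 - l3 (l20 x2 x4) x1 x3 + l3 (l20 x3 x4) x1 x2
       = (- l21 x4 (l3 x1 x2 x3)) - (- l21 x3 (l3 x1 x2 x4))
         + (- l21 x2 (l3 x1 x3 x4)) - (- l21 x1 (l3 x2 x3 x4))"


section \<open>Smooth functions on a dual space\<close>

text \<open>The continuity condition refers to the topology of pointwise convergence on linear
  functionals, which on the dual of a finite-dimensional space is the standard one.\<close>

coinductive smooth :: "('m::real_vector dual \<Rightarrow> real) \<Rightarrow> bool" where
  "\<lbrakk>continuous_on (Collect linear) (\<lambda>g. f (Lin g));
    \<And>\<alpha> \<beta>. ((\<lambda>t. f (\<alpha> + t *\<^sub>R \<beta>)) has_real_derivative f' \<beta> \<alpha>) (at 0);
    \<And>\<beta>. smooth (f' \<beta>)\<rbrakk> \<Longrightarrow> smooth f"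

definition smooth_section ::
    "('m::real_vector dual \<Rightarrow> 'x::real_vector dual \<times> 'x) \<Rightarrow> bool" where
  "smooth_section e \<longleftrightarrow> (\<forall>y. smooth (\<lambda>\<alpha>. fst (e \<alpha>) y)) \<and> (\<forall>\<eta>::'x dual. smooth (\<lambda>\<alpha>. \<eta> (snd (e \<alpha>))))"


section \<open>The 2-term L-infinity algebra of a Courant algebroid\<close>

text \<open>Structure data of a Courant algebroid on a trivial bundle with base \<open>'p\<close> and fibre \<open>'f\<close>;
  a section is a map \<open>'p \<Rightarrow> 'f\<close>, and \<open>anchor e f\<close> is the function \<open>\<rho>(e) f\<close>.\<close>

record ('p, 'f) courant =
  base_funs :: "('p \<Rightarrow> real) set"
  sections :: "('p \<Rightarrow> 'f) set"
  metric :: "'f \<Rightarrow> 'f \<Rightarrow> real"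
  anchor :: "('p \<Rightarrow> 'f) \<Rightarrow> ('p \<Rightarrow> real) \<Rightarrow> 'p \<Rightarrow> real"
  dorfman :: "('p \<Rightarrow> 'f) \<Rightarrow> ('p \<Rightarrow> 'f) \<Rightarrow> 'p \<Rightarrow> 'f"

definition pairing :: "('p, 'f) courant \<Rightarrow> ('p \<Rightarrow> 'f) \<Rightarrow> ('p \<Rightarrow> 'f) \<Rightarrow> 'p \<Rightarrow> real" where
  "pairing E e1 e2 = (\<lambda>p. metric E (e1 p) (e2 p))"

definition Dop :: "('p, 'f) courant \<Rightarrow> ('p \<Rightarrow> real) \<Rightarrow> 'p \<Rightarrow> 'f" where
  "Dop E f = (THE s. s \<in> sections E \<and> (\<forall>e\<in>sections E. pairing E e s = anchor E e f))"

definition courant_bracket ::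
    "('p, 'f::real_vector) courant \<Rightarrow> ('p \<Rightarrow> 'f) \<Rightarrow> ('p \<Rightarrow> 'f) \<Rightarrow> 'p \<Rightarrow> 'f" where
  "courant_bracket E e1 e2 = (\<lambda>p. (1/2) *\<^sub>R (dorfman E e1 e2 p - dorfman E e2 e1 p))"

definition Tfun ::
    "('p, 'f::real_vector) courant \<Rightarrow> ('p \<Rightarrow> 'f) \<Rightarrow> ('p \<Rightarrow> 'f) \<Rightarrow> ('p \<Rightarrow> 'f) \<Rightarrow> 'p \<Rightarrow> real" where
  "Tfun E e1 e2 e3 = (\<lambda>p. (1/6) * (pairing E (courant_bracket E e1 e2) e3 p
     + pairing E (courant_bracket E e2 e3) e1 p + pairing E (courant_bracket E e3 e1) e2 p))"

definition CA_l1 :: "('p, 'f) courant \<Rightarrow> ('p \<Rightarrow> real) \<Rightarrow> 'p \<Rightarrow> 'f" where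
  "CA_l1 E f = Dop E f"

definition CA_l20 ::
    "('p, 'f::real_vector) courant \<Rightarrow> ('p \<Rightarrow> 'f) \<Rightarrow> ('p \<Rightarrow> 'f) \<Rightarrow> 'p \<Rightarrow> 'f" where
  "CA_l20 E e1 e2 = courant_bracket E e1 e2"

definition CA_l21 :: "('p, 'f) courant \<Rightarrow> ('p \<Rightarrow> 'f) \<Rightarrow> ('p \<Rightarrow> real) \<Rightarrow> 'p \<Rightarrow> real" where
  "CA_l21 E e f = (\<lambda>p. (1/2) * pairing E e (Dop E f) p)"

definition CA_l3 ::
    "('p, 'f::real_vector) courant \<Rightarrow> ('p \<Rightarrow> 'f) \<Rightarrow> ('p \<Rightarrow> 'f) \<Rightarrow> ('p \<Rightarrow> 'f) \<Rightarrow> 'p \<Rightarrow> real" where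
  "CA_l3 E e1 e2 e3 = (\<lambda>p. - Tfun E e1 e2 e3 p)"

text \<open>The operations \<open>t1, t20, t21, t3\<close> are those of the 2-term L-infinity algebra of \<open>E\<close>
  restricted to the linear subspaces \<open>range j1\<close> of functions and \<open>range j0\<close> of sections (in
  particular these subspaces are closed under the operations). Since \<open>j1\<close> and \<open>j0\<close> are
  injective, \<open>t1, t20, t21, t3\<close> are unique.\<close>

definition is_restriction ::
    "('p, 'f::real_vector) courant \<Rightarrow> ('v::real_vector \<Rightarrow> 'p \<Rightarrow> real) \<Rightarrow> ('w::real_vector \<Rightarrow> 'p \<Rightarrow> 'f)
      \<Rightarrow> ('v \<Rightarrow> 'w) \<Rightarrow> ('w \<Rightarrow> 'w \<Rightarrow> 'w) \<Rightarrow> ('w \<Rightarrow> 'v \<Rightarrow> 'v) \<Rightarrow> ('w \<Rightarrow> 'w \<Rightarrow> 'w \<Rightarrow> 'v) \<Rightarrow> bool" where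
  "is_restriction E j1 j0 t1 t20 t21 t3 \<longleftrightarrow>
     inj j1 \<and> range j1 \<subseteq> base_funs E \<and> (\<forall>p. linear (\<lambda>v. j1 v p)) \<and>
     inj j0 \<and> range j0 \<subseteq> sections E \<and> (\<forall>p. linear (\<lambda>w. j0 w p)) \<and>
     (\<forall>v. CA_l1 E (j1 v) = j0 (t1 v)) \<and>
     (\<forall>u w. CA_l20 E (j0 u) (j0 w) = j0 (t20 u w)) \<and>
     (\<forall>w v. CA_l21 E (j0 w) (j1 v) = j1 (t21 w v)) \<and>
     (\<forall>u v w. CA_l3 E (j0 u) (j0 v) (j0 w) = j1 (t3 u v w))"


section \<open>Functions on the graded manifold and their Poisson bracket\<close>

text \<open>The Grassmann algebra on generators \<open>\<theta>\<^sub>0, \<theta>\<^sub>1, \<dots>\<close>: a set \<open>U = {i\<^sub>1 < \<dots> < i\<^sub>k}\<close> stands for the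
  monomial \<open>\<theta>\<^bsub>i\<^sub>1\<^esub> \<dots> \<theta>\<^bsub>i\<^sub>k\<^esub>\<close>, and an element is its family of coefficients.\<close>

type_synonym grassmann = "nat set \<Rightarrow> real"

definition gone :: grassmann where
  "gone U = (if U = {} then 1 else 0)"

definition gen :: "nat \<Rightarrow> grassmann" where
  "gen i U = (if U = {i} then 1 else 0)"

definition gmul :: "grassmann \<Rightarrow> grassmann \<Rightarrow> grassmann" where
  "gmul a b U = (\<Sum>S\<in>Pow U. (-1) ^ card {(i, j). i \<in> S \<and> j \<in> U - S \<and> j < i} * a S * b (U - S))"

text \<open>Left and right partial derivatives with respect to \<open>\<theta>\<^sub>i\<close>.\<close>

definition lder :: "nat \<Rightarrow> grassmann \<Rightarrow> grassmann" where
  "lder i a U = (if i \<in> U then 0 else (-1) ^ card {j \<in> U. j < i} * a (insert i U))"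

definition rder :: "nat \<Rightarrow> grassmann \<Rightarrow> grassmann" where
  "rder i a U = (if i \<in> U then 0 else (-1) ^ card {j \<in> U. i < j} * a (insert i U))"

text \<open>Functions on \<open>T\<^sup>*[2]\<gg>\<^sup>*[1]\<close>. The generators \<open>m\<close> (degree 0) are functions of a point
  \<open>\<alpha>\<close> of the dual of \<open>'m\<close>, the generators of degree 2 are functions of a fibre coordinate
  \<open>p :: 'm\<close>. For a basis \<open>bx\<close> of the degree 0 part \<open>'x\<close>, of length \<open>d\<close>, the odd generators are
  \<open>\<theta>\<^sub>i = bx ! i\<close> and \<open>\<theta>\<^bsub>d+i\<^esub> = coord bx i\<close> for \<open>i < d\<close>.\<close>

type_synonym 'm gfun = "'m dual \<Rightarrow> 'm \<Rightarrow> grassmann"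

definition g_fun :: "('m::real_vector dual \<Rightarrow> real) \<Rightarrow> 'm gfun" where
  "g_fun f = (\<lambda>\<alpha> p U. f \<alpha> * gone U)"

definition g_mom :: "'m::real_vector dual \<Rightarrow> 'm gfun" where
  "g_mom \<beta> = (\<lambda>\<alpha> p U. \<beta> p * gone U)"

definition odd_x :: "'x::real_vector list \<Rightarrow> 'x \<Rightarrow> grassmann" where
  "odd_x bx x U = (\<Sum>i<length bx. coord bx i x * gen i U)"

definition odd_xi :: "'x::real_vector list \<Rightarrow> 'x dual \<Rightarrow> grassmann" where
  "odd_xi bx \<xi> U = (\<Sum>i<length bx. \<xi> (bx ! i) * gen (length bx + i) U)"

definition g_sec :: "'x::real_vector list \<Rightarrow> ('m::real_vector dual \<Rightarrow> 'x dual \<times> 'x) \<Rightarrow> 'm gfun" where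
  "g_sec bx e = (\<lambda>\<alpha> p U. odd_xi bx (fst (e \<alpha>)) U + odd_x bx (snd (e \<alpha>)) U)"

definition dq :: "'m::real_vector dual \<Rightarrow> 'm gfun \<Rightarrow> 'm gfun" where
  "dq \<beta> F = (\<lambda>\<alpha> p U. deriv (\<lambda>t. F (\<alpha> + t *\<^sub>R \<beta>) p U) 0)"

definition dp :: "'m::real_vector \<Rightarrow> 'm gfun \<Rightarrow> 'm gfun" where
  "dp n F = (\<lambda>\<alpha> p U. deriv (\<lambda>t. F \<alpha> (p + t *\<^sub>R n) U) 0)"

definition poisson ::
    "'m::real_vector list \<Rightarrow> 'x::real_vector list \<Rightarrow> 'm gfun \<Rightarrow> 'm gfun \<Rightarrow> 'm gfun" where
  "poisson bm bx F G = (\<lambda>\<alpha> p U.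
     (\<Sum>a<length bm. gmul (dq (coord bm a) F \<alpha> p) (dp (bm ! a) G \<alpha> p) U
                   - gmul (dp (bm ! a) F \<alpha> p) (dq (coord bm a) G \<alpha> p) U)
   + (\<Sum>i<length bx. gmul (rder i (F \<alpha> p)) (lder (length bx + i) (G \<alpha> p)) U
                   + gmul (rder (length bx + i) (F \<alpha> p)) (lder i (G \<alpha> p)) U))"


section \<open>The Courant algebroid of a 2-term L-infinity algebra\<close>

text \<open>The structure maps as functions of degree 3; their normalization is verified at the end
  of the theory.\<close>

definition l1_fun :: "'x::real_vector list \<Rightarrow> ('m::real_vector \<Rightarrow> 'x) \<Rightarrow> 'm gfun" where
  "l1_fun bx l1 = (\<lambda>\<alpha> p. odd_x bx (l1 p))"

definition l20_fun :: "'x::real_vector list \<Rightarrow> ('x \<Rightarrow> 'x \<Rightarrow> 'x) \<Rightarrow> 'm::real_vector gfun" where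
  "l20_fun bx l20 = (\<lambda>\<alpha> p U. (1/2) * (\<Sum>i<length bx. \<Sum>j<length bx.
     gmul (gen (length bx + i)) (gmul (gen (length bx + j)) (odd_x bx (l20 (bx ! i) (bx ! j)))) U))"

definition l21_fun :: "'x::real_vector list \<Rightarrow> ('x \<Rightarrow> 'm \<Rightarrow> 'm) \<Rightarrow> 'm::real_vector gfun" where
  "l21_fun bx l21 = (\<lambda>\<alpha> p U. \<Sum>i<length bx. \<alpha> (l21 (bx ! i) p) * gen (length bx + i) U)"

definition l3_fun :: "'x::real_vector list \<Rightarrow> ('x \<Rightarrow> 'x \<Rightarrow> 'x \<Rightarrow> 'm) \<Rightarrow> 'm::real_vector gfun" where
  "l3_fun bx l3 = (\<lambda>\<alpha> p U. (1/6) * (\<Sum>i<length bx. \<Sum>j<length bx. \<Sum>k<length bx.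
     \<alpha> (l3 (bx ! i) (bx ! j) (bx ! k)) *
     gmul (gen (length bx + i)) (gmul (gen (length bx + j)) (gen (length bx + k))) U))"

definition Theta ::
    "'x::real_vector list \<Rightarrow> ('m::real_vector \<Rightarrow> 'x) \<Rightarrow> ('x \<Rightarrow> 'x \<Rightarrow> 'x) \<Rightarrow> ('x \<Rightarrow> 'm \<Rightarrow> 'm)
      \<Rightarrow> ('x \<Rightarrow> 'x \<Rightarrow> 'x \<Rightarrow> 'm) \<Rightarrow> 'm gfun" where
  "Theta bx l1 l20 l21 l3 = (\<lambda>\<alpha> p U.
     - (l1_fun bx l1 \<alpha> p U + l20_fun bx l20 \<alpha> p U + l21_fun bx l21 \<alpha> p U + l3_fun bx l3 \<alpha> p U))"

definition assoc_courant ::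
    "'m::real_vector list \<Rightarrow> 'x::real_vector list
      \<Rightarrow> ('m \<Rightarrow> 'x) \<Rightarrow> ('x \<Rightarrow> 'x \<Rightarrow> 'x) \<Rightarrow> ('x \<Rightarrow> 'm \<Rightarrow> 'm) \<Rightarrow> ('x \<Rightarrow> 'x \<Rightarrow> 'x \<Rightarrow> 'm)
      \<Rightarrow> ('m dual, 'x dual \<times> 'x) courant" where
  "assoc_courant bm bx l1 l20 l21 l3 =
     (let \<Theta> = Theta bx l1 l20 l21 l3 in
      \<lparr>base_funs = Collect smooth,
       sections = Collect smooth_section,
       metric = (\<lambda>(\<xi>, x) (\<eta>, y). \<xi> y + \<eta> x),
       anchor = (\<lambda>e f. THE h. g_fun h = poisson bm bx (poisson bm bx (g_sec bx e) \<Theta>) (g_fun f)),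
       dorfman = (\<lambda>e1 e2. THE e.
         g_sec bx e = poisson bm bx (poisson bm bx (g_sec bx e1) \<Theta>) (g_sec bx e2))\<rparr>)"

definition lin_fun :: "'m::real_vector \<Rightarrow> 'm dual \<Rightarrow> real" where
  "lin_fun m = (\<lambda>\<alpha>. \<alpha> m)"

text \<open>The section \<open>x + h\<close>: the constant \<open>x\<close> plus the linear section of \<open>h\<close>. For
  \<open>h = \<xi> \<otimes> m\<close> the latter is \<open>\<alpha> \<mapsto> \<langle>\<alpha>, m\<rangle> \<xi>\<close>.\<close>

definition lin_sec ::
    "'x::real_vector \<times> ('x, 'm::real_vector) lin \<Rightarrow> 'm dual \<Rightarrow> 'x dual \<times> 'x" where
  "lin_sec = (\<lambda>(x, h) \<alpha>. (Lin (\<lambda>y. \<alpha> (h y)), x))"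


section \<open>Notation for the operations\<close>

text \<open>\<open>cyc F\<close> is \<open>F(1,2,3) + c.p.\<close>\<close>

definition cyc :: "(nat \<Rightarrow> nat \<Rightarrow> nat \<Rightarrow> 'a::plus) \<Rightarrow> 'a" where
  "cyc F = F 1 2 3 + F 2 3 1 + F 3 1 2"

text \<open>\<open>l\<^sub>2\<^sup>1(m, \<cdot>)\<close>, \<open>l\<^sub>3(x, y, \<cdot>)\<close>, \<open>l\<^sub>1\<^sup>*\<xi>\<close> and \<open>l\<^sub>2\<^sup>0(x, \<cdot>)\<^sup>*\<xi>\<close>; note \<open>l\<^sub>2\<^sup>1(m, y) = - l\<^sub>2\<^sup>1(y, m)\<close>.\<close>

definition l21_at :: "('x::real_vector \<Rightarrow> 'm::real_vector \<Rightarrow> 'm) \<Rightarrow> 'm \<Rightarrow> ('x, 'm) lin" where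
  "l21_at l21 m = Lin (\<lambda>y. - l21 y m)"

definition l3_at ::
    "('x::real_vector \<Rightarrow> 'x \<Rightarrow> 'x \<Rightarrow> 'm::real_vector) \<Rightarrow> 'x \<Rightarrow> 'x \<Rightarrow> ('x, 'm) lin" where
  "l3_at l3 x y = Lin (\<lambda>z. l3 x y z)"

definition l1_dual :: "('m::real_vector \<Rightarrow> 'x::real_vector) \<Rightarrow> 'x dual \<Rightarrow> 'm dual" where
  "l1_dual l1 \<xi> = Lin (\<lambda>m. - \<xi> (l1 m))"

definition l20_dual :: "('x::real_vector \<Rightarrow> 'x \<Rightarrow> 'x) \<Rightarrow> 'x \<Rightarrow> 'x dual \<Rightarrow> 'x dual" where
  "l20_dual l20 x \<xi> = Lin (\<lambda>y. - \<xi> (l20 x y))"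

section \<open>Poisson brackets of generators and normalization of the degree 3 functions\<close>

lemma lin_app_linear: "linear (lin_app f)" using lin_app[of f] by simp

lemma lin_app_simps [simp]:
  "lin_app (f + g) x = lin_app f x + lin_app g x"
  "lin_app (c *\<^sub>R f) x = c *\<^sub>R lin_app f x"
  by (transfer; simp)+

lemma sum_coord:
  assumes "is_basis bs" "linear f"
  shows "(\<Sum>i<length bs. coord bs i v *\<^sub>R f (bs ! i)) = f v"
proof -
  have d: "distinct bs" and ind: "independent (set bs)" and sp: "span (set bs) = UNIV"
    using assms by (auto simp: is_basis_def)
  have c: "coord bs i v = representation (set bs) v (bs ! i)" for i
    unfolding coord_def
    by (subst Lin_inverse)
      (auto simp: linear_iff real_vector.representation_add[OF ind] real_vector.representation_scale[OF ind] sp)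
  have "(\<Sum>i<length bs. coord bs i v *\<^sub>R f (bs ! i))
      = (\<Sum>b\<in>set bs. representation (set bs) v b *\<^sub>R f b)"
    unfolding c by (rule sum.reindex_bij_betw[OF bij_betw_nth[OF d refl refl]])
  also have "\<dots> = f (\<Sum>b\<in>set bs. representation (set bs) v b *\<^sub>R b)"
    by (simp add: linear_sum[OF assms(2)] linear_cmul[OF assms(2)])
  also have "(\<Sum>b\<in>set bs. representation (set bs) v b *\<^sub>R b) = v"
    by (rule real_vector.sum_representation_eq[OF ind]) (auto simp: sp)
  finally show ?thesis .
qed

lemma gmul_gen:
  "gmul (gen i) a U = (if finite U \<and> i \<in> U then (-1) ^ card {j \<in> U. j < i} * a (U - {i}) else 0)"
proof (cases "finite U")
  case True
  have "gmul (gen i) a U = (\<Sum>S\<in>Pow U. if S = {i} then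
      (-1) ^ card {(i, j). i \<in> S \<and> j \<in> U - S \<and> j < i} * a (U - S) else 0)"
    unfolding gmul_def gen_def by (rule sum.cong) auto
  also have "\<dots> = (if i \<in> U then (-1) ^ card {(k, j). k \<in> {i} \<and> j \<in> U - {i} \<and> j < k} * a (U - {i}) else 0)"
    using True by (simp add: sum.delta)
  also have "{(k, j). k \<in> {i} \<and> j \<in> U - {i} \<and> j < k} = Pair i ` {j \<in> U. j < i}" by auto
  finally show ?thesis using True by (simp add: card_image inj_on_def)
qed (simp add: gmul_def)

lemma gmul_gone: 
  "gmul (\<lambda>U. c * gone U) a U = (if finite U then c * a U else 0)"
proof (cases "finite U")
  case True
  have "gmul (\<lambda>U. c * gone U) a U = (\<Sum>S\<in>Pow U. if S = {} then c * a U else 0)"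
    unfolding gmul_def gone_def by (rule sum.cong) auto
  then show ?thesis using True by simp
qed (simp add: gmul_def)

lemma gmul_gone': 
  "gmul a (\<lambda>U. c * gone U) U = (if finite U then c * a U else 0)"
proof (cases "finite U")
  case True
  have "gmul a (\<lambda>U. c * gone U) U = (\<Sum>S\<in>Pow U. if S = U then c * a U else 0)"
    unfolding gmul_def gone_def
  proof (rule sum.cong)
    fix S assume "S \<in> Pow U"
    then have "U - S = {} \<longleftrightarrow> S = U" by auto
    moreover have "{(i, j). i \<in> U \<and> j \<in> U \<and> j \<notin> U \<and> j < i} = {}" by auto
    ultimately show "(- 1) ^ card {(i, j). i \<in> S \<and> j \<in> U - S \<and> j < i} * a S * (c * (if U - S = {} then 1 else 0)) =
         (if S = U then c * a U else 0)" by (cases "S = U") simp_all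
  qed simp
  then show ?thesis using True by simp
qed (simp add: gmul_def)

lemma gmul_0 [simp]: "gmul (\<lambda>_. 0) a = (\<lambda>_. 0)" "gmul a (\<lambda>_. 0) = (\<lambda>_. 0)"
  by (auto simp: gmul_def)

lemma der_gen:
  "lder i (gen j) = (\<lambda>U. (if i = j then 1 else 0) * gone U)"
  "rder i (gen j) = (\<lambda>U. (if i = j then 1 else 0) * gone U)"
  by (auto simp: lder_def rder_def gen_def gone_def fun_eq_iff)

lemma der_gone [simp]: "lder i (\<lambda>U. c * gone U) = (\<lambda>_. 0)" "rder i (\<lambda>U. c * gone U) = (\<lambda>_. 0)"
  by (auto simp: lder_def rder_def gone_def fun_eq_iff)

lemma lder_gmul_gen:
  "lder i (gmul (gen j) a) U =
     (if i = j \<and> finite U then a U else 0) - gmul (gen j) (lder i a) U"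
proof (cases "finite U")
  case fin: True
  show ?thesis
  proof (cases "i \<in> U")
    case True
    show ?thesis
    proof (cases "j \<in> U \<and> i = j")
      case True
      then have "{k \<in> U - {i}. k < i} = {k \<in> U. k < i}" "insert i (U - {i}) = U" by auto
      then show ?thesis using True fin
        by (simp add: lder_def gmul_gen flip: mult.assoc power_add)
    next
      case False
      then show ?thesis using True fin by (auto simp: lder_def gmul_gen)
    qed
  next
    case ni: False
    show ?thesis
    proof (cases "i = j")
      case True
      have "{k \<in> insert j U. k < j} = {k \<in> U. k < j}" by auto
      then show ?thesis using ni fin True 
        by (simp add: lder_def gmul_gen flip: mult.assoc power_add)
    next
      case ij: False
      show ?thesis
      proof (cases "j \<in> U")
        case True
        have "insert i U - {j} = insert i (U - {j})" using ij by auto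
        moreover have "card {k \<in> U. k < i} = card {k \<in> U - {j}. k < i} + (if j < i then 1 else 0)"
        proof (cases "j < i")
          case lt: True
          then have "{k \<in> U. k < i} = insert j {k \<in> U - {j}. k < i}" using True by auto
          then show ?thesis using fin lt by simp
        next
          case False
          then have "{k \<in> U. k < i} = {k \<in> U - {j}. k < i}" by auto
          then show ?thesis using False by simp
        qed
        moreover have "card {k \<in> insert i U. k < j} = card {k \<in> U. k < j} + (if i < j then 1 else 0)"
        proof (cases "i < j")
          case lt: True
          then have "{k \<in> insert i U. k < j} = insert i {k \<in> U. k < j}" by auto
          then show ?thesis using fin lt ni by simp
        next
          case False
          then have "{k \<in> insert i U. k < j} = {k \<in> U. k < j}" by auto
          then show ?thesis using False by simp
        qed
        ultimately show ?thesis using ni fin True ij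
          by (auto simp: lder_def gmul_gen power_add)
      next
        case False
        then show ?thesis using ni fin ij by (auto simp: lder_def gmul_gen)
      qed
    qed
  qed
qed (auto simp: lder_def gmul_gen)


lemma lder_lin [simp]:
  "lder i (\<lambda>U. \<Sum>j\<in>J. a j U) = (\<lambda>U. \<Sum>j\<in>J. lder i (a j) U)"
  "lder i (\<lambda>U. c * b U) = (\<lambda>U. c * lder i b U)"
  by (auto simp: lder_def fun_eq_iff sum_distrib_left)

lemma rder_lin [simp]:
  "rder i (\<lambda>U. \<Sum>j\<in>J. a j U) = (\<lambda>U. \<Sum>j\<in>J. rder i (a j) U)"
  "rder i (\<lambda>U. c * b U) = (\<lambda>U. c * rder i b U)"
  by (auto simp: rder_def fun_eq_iff sum_distrib_left)

lemma lder_gmul_gen':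
  assumes "\<And>U. infinite U \<Longrightarrow> a U = 0"
  shows "lder i (gmul (gen j) a) = (\<lambda>U. (if i = j then 1 else 0) * a U - gmul (gen j) (lder i a) U)"
  using assms by (auto simp: fun_eq_iff lder_gmul_gen)

lemma odd_inf: "infinite U \<Longrightarrow> odd_x bx x U = 0" "infinite U \<Longrightarrow> gmul a b U = 0"
   "infinite U \<Longrightarrow> gen i U = 0" "infinite U \<Longrightarrow> gone U = 0" "infinite U \<Longrightarrow> odd_xi bx \<xi> U = 0"
  by (auto simp: odd_x_def odd_xi_def gmul_def gen_def gone_def intro!: sum.neutral)

lemma lder_odd [simp]:
  "i < length bx \<Longrightarrow> lder i (odd_x bx x) = (\<lambda>U. coord bx i x * gone U)"
  "lder (length bx + i) (odd_x bx x) = (\<lambda>_. 0)"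
  "i < length bx \<Longrightarrow> lder i (odd_xi bx \<xi>) = (\<lambda>_. 0)"
  "i < length bx \<Longrightarrow> lder (length bx + i) (odd_xi bx \<xi>) = (\<lambda>U. \<xi> (bx ! i) * gone U)"
  "i < length bx \<Longrightarrow> rder i (odd_x bx x) = (\<lambda>U. coord bx i x * gone U)"
  "rder (length bx + i) (odd_x bx x) = (\<lambda>_. 0)"
  "i < length bx \<Longrightarrow> rder i (odd_xi bx \<xi>) = (\<lambda>_. 0)"
  "i < length bx \<Longrightarrow> rder (length bx + i) (odd_xi bx \<xi>) = (\<lambda>U. \<xi> (bx ! i) * gone U)"
  unfolding odd_x_def[abs_def] odd_xi_def[abs_def]
  by (auto simp: der_gen fun_eq_iff if_distrib if_distribR cong: if_cong intro!: sum.neutral)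

lemma poisson_x:
  "poisson bm bx (\<lambda>_ _. odd_x bx x) G \<alpha> p U =
     (if finite U then \<Sum>i<length bx. coord bx i x * lder (length bx + i) (G \<alpha> p) U else 0)"
  by (simp add: poisson_def dq_def dp_def gmul_gone)

lemma deriv_affine: "deriv (\<lambda>t::real. (c + t * d) * b) 0 = d * b"
  by (intro DERIV_imp_deriv) (auto intro!: derivative_eq_intros)

lemma poisson_m:
  fixes m :: "'m::real_vector"
  shows "poisson bm bx (g_fun (lin_fun m)) G \<alpha> p U =
     (if finite U then \<Sum>a<length bm. coord bm a m * dp (bm ! a) G \<alpha> p U else 0)"
proof -
  have 1: "dq \<beta> (g_fun (lin_fun m)) = (\<lambda>_ _ U. \<beta> m * gone U)" for \<beta>
    by (simp add: fun_eq_iff dq_def g_fun_def lin_fun_def deriv_affine)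
  have 2: "dp \<beta> (g_fun (lin_fun m)) = (\<lambda>_ _ U. 0)" for \<beta>
    by (simp add: fun_eq_iff dp_def g_fun_def lin_fun_def)
  show ?thesis
    unfolding poisson_def 1 2 by (simp add: gmul_gone) (simp add: g_fun_def)
qed

lemma g_sec_simps: "g_sec bx (\<lambda>_. (0, x)) = (\<lambda>_ _. odd_x bx x)" "g_sec bx (\<lambda>\<alpha>. (f \<alpha>, 0)) = (\<lambda>\<alpha> _. odd_xi bx (f \<alpha>))"
  if "is_basis bx"
proof -
  have "coord bx i 0 = 0" for i by (simp add: linear_0 lin_app_linear)
  moreover have "(0::'a dual) v = 0" for v by transfer simp
  ultimately show "g_sec bx (\<lambda>_. (0, x)) = (\<lambda>_ _. odd_x bx x)" "g_sec bx (\<lambda>\<alpha>. (f \<alpha>, 0)) = (\<lambda>\<alpha> _. odd_xi bx (f \<alpha>))"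
    by (simp_all add: g_sec_def fun_eq_iff odd_x_def odd_xi_def)
qed

lemma linear_odd_x: "linear (\<lambda>x. odd_x bx x U)"
  by (auto simp: linear_iff odd_x_def linear_add[OF lin_app_linear] linear_cmul[OF lin_app_linear]
     sum.distrib sum_distrib_left algebra_simps)

text \<open>The next two lemmas are \<open>{x, \<xi>} = \<langle>\<xi>, x\<rangle>\<close> and \<open>{m, \<alpha>} = \<langle>\<alpha>, m\<rangle>\<close>.\<close>

lemma poisson_x_xi:
  assumes "is_basis bx"
  shows "poisson bm bx (g_sec bx (\<lambda>_. (0, x))) (g_sec bx (\<lambda>_. (\<xi>, 0))) = g_fun (\<lambda>_. \<xi> x)"
proof (intro ext)
  fix \<alpha> p U
  have "(\<Sum>i<length bx. coord bx i x * \<xi> (bx ! i)) = \<xi> x"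
    using sum_coord[OF assms lin_app_linear[of \<xi>], of x] by simp
  then show "poisson bm bx (g_sec bx (\<lambda>_. (0, x))) (g_sec bx (\<lambda>_. (\<xi>, 0))) \<alpha> p U = g_fun (\<lambda>_. \<xi> x) \<alpha> p U"
    by (simp add: g_sec_simps[OF assms] poisson_x g_fun_def odd_inf flip: sum_distrib_right mult.assoc)
qed

lemma poisson_m_mom:
  assumes "is_basis bm"
  shows "poisson bm bx (g_fun (lin_fun m)) (g_mom \<beta>) = g_fun (\<lambda>_. \<beta> m)"
proof (intro ext)
  fix \<alpha> p U
  have "(\<Sum>i<length bm. coord bm i m * \<beta> (bm ! i)) = \<beta> m"
    using sum_coord[OF assms lin_app_linear[of \<beta>], of m] by simp
  moreover have "dp n (g_mom \<beta>) = (\<lambda>_ _ U. \<beta> n * gone U)" for n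
    by (simp add: dp_def g_mom_def fun_eq_iff linear_add[OF lin_app_linear] linear_cmul[OF lin_app_linear] deriv_affine)
  ultimately show "poisson bm bx (g_fun (lin_fun m)) (g_mom \<beta>) \<alpha> p U = g_fun (\<lambda>_. \<beta> m) \<alpha> p U"
    by (simp add: poisson_m odd_inf flip: sum_distrib_right mult.assoc) (simp add: g_fun_def odd_inf)
qed

text \<open>The next four lemmas are \<open>l\<^sub>1(m) = {m, l\<^sub>1}\<close>, \<open>l\<^sub>2\<^sup>1(x, m) = {m, {x, l\<^sub>2\<^sup>1}}\<close>,
  \<open>l\<^sub>2\<^sup>0(x, y) = {y, {x, l\<^sub>2\<^sup>0}}\<close> and \<open>l\<^sub>3(x, y, \<cdot>) = {y, {x, l\<^sub>3}}\<close>.\<close>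

lemma l1_fun_normalized:
  assumes "is_basis bm" "is_basis bx" "linear l1"
  shows "poisson bm bx (g_fun (lin_fun m)) (l1_fun bx l1) = g_sec bx (\<lambda>_. (0, l1 m))"
proof (intro ext)
  fix \<alpha> p U
  have lin: "linear (\<lambda>n. odd_x bx (l1 n) U)"
    using linear_compose[OF assms(3) linear_odd_x] by (simp add: o_def)
  have "dp n (l1_fun bx l1) \<alpha> p U = odd_x bx (l1 n) U" for n
    using deriv_affine[of "odd_x bx (l1 p) U" "odd_x bx (l1 n) U" 1]
    by (simp add: dp_def l1_fun_def linear_add[OF lin] linear_cmul[OF lin])
  then show "poisson bm bx (g_fun (lin_fun m)) (l1_fun bx l1) \<alpha> p U = g_sec bx (\<lambda>_. (0, l1 m)) \<alpha> p U"
    using sum_coord[OF assms(1) lin, of m]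
    by (simp add: poisson_m g_sec_simps[OF assms(2)] odd_inf)
qed

lemma l21_fun_normalized:
  fixes l21 :: "'b::real_vector \<Rightarrow> 'a::real_vector \<Rightarrow> 'a"
  assumes "is_basis bm" "is_basis bx" "bilinear l21"
  shows "poisson bm bx (g_fun (lin_fun m)) (poisson bm bx (g_sec bx (\<lambda>_. (0, x))) (l21_fun bx l21))
    = g_fun (lin_fun (l21 x m))"
proof (intro ext)
  fix \<alpha> :: "'a dual" and p U
  have lx: "linear (\<lambda>x. \<alpha> (l21 x n))" for \<alpha> :: "'a dual" and n
    using assms(3) linear_compose[OF _ lin_app_linear[of \<alpha>]] by (auto simp: bilinear_def o_def)
  have lm: "linear (\<lambda>m. \<alpha> (l21 x m))" for \<alpha> :: "'a dual" and x
    using assms(3) linear_compose[OF _ lin_app_linear[of \<alpha>]] by (auto simp: bilinear_def o_def)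
  have 1: "poisson bm bx (g_sec bx (\<lambda>_. (0, x))) (l21_fun bx l21) = (\<lambda>\<alpha> p U. \<alpha> (l21 x p) * gone U)"
  proof (intro ext)
    fix \<alpha> :: "'a dual" and p U
    have "lder (length bx + i) (l21_fun bx l21 \<alpha> p) = (\<lambda>U. \<alpha> (l21 (bx ! i) p) * gone U)" if "i < length bx" for i
      using that unfolding l21_fun_def 
      by (auto simp: der_gen fun_eq_iff if_distrib if_distribR cong: if_cong)
    then show "poisson bm bx (g_sec bx (\<lambda>_. (0, x))) (l21_fun bx l21) \<alpha> p U = \<alpha> (l21 x p) * gone U"
      using sum_coord[OF assms(2) lx, of x]
      by (simp add: poisson_x g_sec_simps[OF assms(2)] odd_inf flip: sum_distrib_right mult.assoc)
  qed
  have "dp n (\<lambda>\<alpha> p U. \<alpha> (l21 x p) * gone U) \<alpha> p U = \<alpha> (l21 x n) * gone U" for n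
    by (simp add: dp_def linear_add[OF lm] linear_cmul[OF lm] deriv_affine)
  then show "poisson bm bx (g_fun (lin_fun m)) (poisson bm bx (g_sec bx (\<lambda>_. (0, x))) (l21_fun bx l21)) \<alpha> p U
      = g_fun (lin_fun (l21 x m)) \<alpha> p U"
    using sum_coord[OF assms(1) lm, of m]
    by (simp add: 1 poisson_m odd_inf flip: sum_distrib_right mult.assoc) (simp add: g_fun_def lin_fun_def odd_inf)
qed


lemma gmul_lin [simp]:
  "gmul a (\<lambda>U. \<Sum>j\<in>J. b j U) = (\<lambda>U. \<Sum>j\<in>J. gmul a (b j) U)"
  "gmul a (\<lambda>U. c * b' U) = (\<lambda>U. c * gmul a b' U)"
proof -
  show "gmul a (\<lambda>U. \<Sum>j\<in>J. b j U) = (\<lambda>U. \<Sum>j\<in>J. gmul a (b j) U)"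
    unfolding gmul_def fun_eq_iff sum_distrib_left by (intro allI sum.swap)
  show "gmul a (\<lambda>U. c * b' U) = (\<lambda>U. c * gmul a b' U)"
    by (auto simp: gmul_def fun_eq_iff sum_distrib_left algebra_simps)
qed

lemma gmul_gen_gone [simp]: "gmul (gen i) gone = gen i"
  using gmul_gone'[of "gen i" 1] by (auto simp: fun_eq_iff odd_inf)

lemma lder_diff [simp]: "lder i (\<lambda>U. a U - b U) = (\<lambda>U. lder i a U - lder i b U)"
  by (auto simp: lder_def fun_eq_iff algebra_simps)

lemma gmul_diff [simp]: "gmul a (\<lambda>U. b U - c U) = (\<lambda>U. gmul a b U - gmul a c U)"
  by (auto simp: gmul_def fun_eq_iff algebra_simps sum_subtractf)

lemma sum_if_mult [simp]:
  "(\<Sum>j<n. (if i = j then 1 else 0) * (f j::real)) = (if i < (n::nat) then f i else 0)"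
  by (simp add: if_distrib if_distribR cong: if_cong)

lemma l20_fun_normalized:
  fixes l20 :: "'x::real_vector \<Rightarrow> 'x \<Rightarrow> 'x"
  assumes bx: "is_basis bx" and bil: "bilinear l20" and skew: "\<And>x y. l20 x y = - l20 y x"
  shows "poisson bm bx (g_sec bx (\<lambda>_. (0, y))) (poisson bm bx (g_sec bx (\<lambda>_. (0, x))) (l20_fun bx l20))
    = g_sec bx (\<lambda>_. (0, l20 x y))"
proof (intro ext)
  fix \<alpha> :: "'a dual" and p U
  let ?d = "length bx"
  let ?O = "\<lambda>i j. odd_x bx (l20 (bx ! i) (bx ! j))"
  have "linear (\<lambda>x. l20 x y)" "linear (l20 x)" for x y using bil by (auto simp: bilinear_def)
  from this[THEN linear_compose, OF linear_odd_x]
  have l: "linear (\<lambda>x. odd_x bx (l20 x y) U)" "linear (\<lambda>y. odd_x bx (l20 x y) U)" for x y U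
    by (simp_all add: o_def)
  have sk: "odd_x bx (l20 x y) U = - odd_x bx (l20 y x) U" for x y U
    by (subst skew) (simp add: linear_neg[OF linear_odd_x])
  have gsk: "gmul a (?O i j) U = - gmul a (?O j i) U" for a i j U
    by (simp add: gmul_def sk[of "bx ! i"] sum_negf[symmetric])
  have d1: "lder (?d + i) (l20_fun bx l20 \<alpha> p) = (\<lambda>U. \<Sum>j<?d. gmul (gen (?d + j)) (?O i j) U)"
    if "i < ?d" for i \<alpha> p
  proof
    fix U
    have "lder (?d + i) (l20_fun bx l20 \<alpha> p) U
       = (1/2) * ((\<Sum>j<?d. gmul (gen (?d + j)) (?O i j) U) - (\<Sum>j<?d. gmul (gen (?d + j)) (?O j i) U))"
      using that unfolding l20_fun_def lder_lin
      by (simp add: lder_gmul_gen' odd_inf sum_subtractf flip: sum_distrib_left)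
    also have "\<dots> = (\<Sum>j<?d. gmul (gen (?d + j)) (?O i j) U)"
      by (subst (2) gsk) (simp add: sum_negf)
    finally show "lder (?d + i) (l20_fun bx l20 \<alpha> p) U = (\<Sum>j<?d. gmul (gen (?d + j)) (?O i j) U)" .
  qed
  have 1: "poisson bm bx (g_sec bx (\<lambda>_. (0, x))) (l20_fun bx l20) =
      (\<lambda>\<alpha> p U. \<Sum>i<?d. coord bx i x * (\<Sum>j<?d. gmul (gen (?d + j)) (?O i j) U))"
    by (auto simp: fun_eq_iff g_sec_simps[OF bx] poisson_x d1 odd_inf)
  have "lder (?d + k) (poisson bm bx (g_sec bx (\<lambda>_. (0, x))) (l20_fun bx l20) \<alpha> p)
      = (\<lambda>U. \<Sum>i<?d. coord bx i x * ?O i k U)" if "k < ?d" for k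
    using that unfolding 1 by (simp add: lder_gmul_gen' odd_inf)
  moreover have "(\<Sum>i<?d. coord bx i x * ?O i k U) = odd_x bx (l20 x (bx ! k)) U" for k
    using sum_coord[OF bx l(1), of x] by simp
  ultimately show "poisson bm bx (g_sec bx (\<lambda>_. (0, y))) (poisson bm bx (g_sec bx (\<lambda>_. (0, x))) (l20_fun bx l20)) \<alpha> p U
    = g_sec bx (\<lambda>_. (0, l20 x y)) \<alpha> p U"
    using sum_coord[OF bx l(2), of y]
    by (simp add: g_sec_simps[OF bx] poisson_x[of _ _ y] odd_inf)
qed

lemma l3_fun_normalized:
  fixes l3 :: "'x::real_vector \<Rightarrow> 'x \<Rightarrow> 'x \<Rightarrow> 'm::real_vector"
  assumes bx: "is_basis bx" and lin: "\<And>y z. linear (\<lambda>x. l3 x y z)"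
    and sk: "\<And>x y z. l3 x y z = - l3 y x z" "\<And>x y z. l3 x y z = - l3 x z y"
  shows "poisson bm bx (g_sec bx (\<lambda>_. (0, y))) (poisson bm bx (g_sec bx (\<lambda>_. (0, x))) (l3_fun bx l3))
    = g_sec bx (lin_sec (0, l3_at l3 x y))"
proof (intro ext)
  fix \<alpha> :: "'m dual" and p U
  let ?d = "length bx"
  let ?g = "\<lambda>i. gen (?d + i)"
  have lin2: "linear (\<lambda>y. l3 x y z)" for x z
    using linear_compose_neg[OF lin[of x z]] by (simp add: sk(1)[symmetric])
  have lin3: "linear (\<lambda>z. l3 x y z)" for x y
    using linear_compose_neg[OF lin2[of x y]] by (simp add: sk(2)[symmetric])
  let ?A = "\<lambda>\<alpha> i j k. lin_app \<alpha> (l3 (bx ! i) (bx ! j) (bx ! k))"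
  have neg: "lin_app \<alpha> (- v) = - lin_app \<alpha> v" for \<alpha> :: "'m dual" and v
    by (rule linear_neg[OF lin_app_linear])
  have A: "?A \<alpha> j i k = - ?A \<alpha> i j k" "?A \<alpha> j k i = ?A \<alpha> i j k" for i j k and \<alpha> :: "'m dual"
  proof -
    show 1: "?A \<alpha> j i k = - ?A \<alpha> i j k" for i j k by (subst sk(1)) (simp add: neg)
    have 2: "?A \<alpha> j k i = - ?A \<alpha> j i k" by (subst sk(2)) (simp add: neg)
    show "?A \<alpha> j k i = ?A \<alpha> i j k" by (simp add: 2 1[of i j])
  qed
  have d1: "lder (?d + i) (l3_fun bx l3 \<alpha> p) = (\<lambda>U. (1/2) * (\<Sum>j<?d. \<Sum>k<?d. ?A \<alpha> i j k * gmul (?g j) (?g k) U))"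
    if i: "i < ?d" for i and \<alpha> :: "'m dual" and p
  proof
    fix U
    have gg: "lder (?d + i) (gmul (?g a) (gmul (?g b) (?g c))) U
       = (if i = a then 1 else 0) * gmul (?g b) (?g c) U
       - (if i = b then 1 else 0) * gmul (?g a) (?g c) U
       + (if i = c then 1 else 0) * gmul (?g a) (?g b) U" for a b c
      by (auto simp: lder_gmul_gen' odd_inf der_gen gmul_gone')
    have "lder (?d + i) (l3_fun bx l3 \<alpha> p) U = (1/6) *
         ((\<Sum>a<?d. \<Sum>b<?d. \<Sum>c<?d. (if i = a then 1 else 0) * (?A \<alpha> a b c * gmul (?g b) (?g c) U))
        - (\<Sum>a<?d. \<Sum>b<?d. \<Sum>c<?d. (if i = b then 1 else 0) * (?A \<alpha> a b c * gmul (?g a) (?g c) U))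
        + (\<Sum>a<?d. \<Sum>b<?d. \<Sum>c<?d. (if i = c then 1 else 0) * (?A \<alpha> a b c * gmul (?g a) (?g b) U)))"
      unfolding l3_fun_def lder_lin gg
      by (simp only: sum.distrib[symmetric] sum_subtractf[symmetric]) (simp add: algebra_simps)
    also have "(\<Sum>a<?d. \<Sum>b<?d. \<Sum>c<?d. (if i = a then 1 else 0) * (?A \<alpha> a b c * gmul (?g b) (?g c) U))
        = (\<Sum>j<?d. \<Sum>k<?d. ?A \<alpha> i j k * gmul (?g j) (?g k) U)"
      using i by (simp only: sum_distrib_left[symmetric] sum_if_mult) simp
    also have "(\<Sum>a<?d. \<Sum>b<?d. \<Sum>c<?d. (if i = b then 1 else 0) * (?A \<alpha> a b c * gmul (?g a) (?g c) U))
        = - (\<Sum>j<?d. \<Sum>k<?d. ?A \<alpha> i j k * gmul (?g j) (?g k) U)"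
      using i by (simp only: sum_distrib_left[symmetric] sum_if_mult) (simp add: A(1)[of _ i] sum_negf)
    also have "(\<Sum>a<?d. \<Sum>b<?d. \<Sum>c<?d. (if i = c then 1 else 0) * (?A \<alpha> a b c * gmul (?g a) (?g b) U))
        = (\<Sum>j<?d. \<Sum>k<?d. ?A \<alpha> i j k * gmul (?g j) (?g k) U)"
      using i by (simp only: sum_distrib_left[symmetric] sum_if_mult) (simp add: A(2)[of _ _ _ i])
    finally show "lder (?d + i) (l3_fun bx l3 \<alpha> p) U = (1/2) * (\<Sum>j<?d. \<Sum>k<?d. ?A \<alpha> i j k * gmul (?g j) (?g k) U)"
      by simp
  qed
  have lin_\<alpha>: "linear (\<lambda>x. lin_app \<alpha> (l3 x y z))" "linear (\<lambda>y. lin_app \<alpha> (l3 x y z))"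
    for \<alpha> :: "'m dual" and x y z
    using linear_compose[OF lin lin_app_linear[of \<alpha>]] linear_compose[OF lin2 lin_app_linear[of \<alpha>]]
    by (auto simp: o_def)
  have 1: "poisson bm bx (g_sec bx (\<lambda>_. (0, x))) (l3_fun bx l3) =
      (\<lambda>\<alpha> p U. (1/2) * (\<Sum>j<?d. \<Sum>k<?d. lin_app \<alpha> (l3 x (bx ! j) (bx ! k)) * gmul (?g j) (?g k) U))"
  proof (intro ext)
    fix \<alpha> :: "'m dual" and p U
    have "poisson bm bx (g_sec bx (\<lambda>_. (0, x))) (l3_fun bx l3) \<alpha> p U
        = (\<Sum>i<?d. coord bx i x * ((1/2) * (\<Sum>j<?d. \<Sum>k<?d. ?A \<alpha> i j k * gmul (?g j) (?g k) U)))"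
      by (simp add: g_sec_simps[OF bx] poisson_x d1 odd_inf)
    also have "\<dots> = (1/2) * (\<Sum>i<?d. \<Sum>j<?d. \<Sum>k<?d. coord bx i x * ?A \<alpha> i j k * gmul (?g j) (?g k) U)"
      by (simp add: sum_distrib_left algebra_simps)
    also have "(\<Sum>i<?d. \<Sum>j<?d. \<Sum>k<?d. coord bx i x * ?A \<alpha> i j k * gmul (?g j) (?g k) U)
        = (\<Sum>j<?d. \<Sum>k<?d. \<Sum>i<?d. coord bx i x * ?A \<alpha> i j k * gmul (?g j) (?g k) U)"
      by (subst sum.swap, rule sum.cong[OF refl], rule sum.swap)
    also have "\<dots> = (\<Sum>j<?d. \<Sum>k<?d. lin_app \<alpha> (l3 x (bx ! j) (bx ! k)) * gmul (?g j) (?g k) U)"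
      using sum_coord[OF bx lin_\<alpha>(1), of x] by (simp flip: sum_distrib_right)
    finally show "poisson bm bx (g_sec bx (\<lambda>_. (0, x))) (l3_fun bx l3) \<alpha> p U = 
       (1/2) * (\<Sum>j<?d. \<Sum>k<?d. lin_app \<alpha> (l3 x (bx ! j) (bx ! k)) * gmul (?g j) (?g k) U)" .
  qed
  have d2: "lder (?d + i) (poisson bm bx (g_sec bx (\<lambda>_. (0, x))) (l3_fun bx l3) \<alpha> p) U
      = (\<Sum>k<?d. lin_app \<alpha> (l3 x (bx ! i) (bx ! k)) * ?g k U)" if i: "i < ?d" for i
  proof -
    have gg: "lder (?d + i) (gmul (?g b) (?g c)) U
       = (if i = b then 1 else 0) * ?g c U - (if i = c then 1 else 0) * ?g b U" for b c
      by (auto simp: lder_gmul_gen' odd_inf der_gen gmul_gone')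
    have "lder (?d + i) (poisson bm bx (g_sec bx (\<lambda>_. (0, x))) (l3_fun bx l3) \<alpha> p) U = (1/2) *
       ((\<Sum>j<?d. \<Sum>k<?d. (if i = j then 1 else 0) * (lin_app \<alpha> (l3 x (bx ! j) (bx ! k)) * ?g k U))
      - (\<Sum>j<?d. \<Sum>k<?d. (if i = k then 1 else 0) * (lin_app \<alpha> (l3 x (bx ! j) (bx ! k)) * ?g j U)))"
      unfolding 1 lder_lin gg
      by (simp only: sum_subtractf[symmetric]) (simp add: algebra_simps)
    also have "(\<Sum>j<?d. \<Sum>k<?d. (if i = j then 1 else 0) * (lin_app \<alpha> (l3 x (bx ! j) (bx ! k)) * ?g k U))
       = (\<Sum>k<?d. lin_app \<alpha> (l3 x (bx ! i) (bx ! k)) * ?g k U)"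
      using i by (simp only: sum_distrib_left[symmetric] sum_if_mult) simp
    also have "(\<Sum>j<?d. \<Sum>k<?d. (if i = k then 1 else 0) * (lin_app \<alpha> (l3 x (bx ! j) (bx ! k)) * ?g j U))
       = - (\<Sum>k<?d. lin_app \<alpha> (l3 x (bx ! i) (bx ! k)) * ?g k U)"
      using i by (simp only: sum_if_mult) (simp add: sk(2)[of x _ "bx ! i"] neg sum_negf)
    finally show ?thesis by simp
  qed
  have "poisson bm bx (g_sec bx (\<lambda>_. (0, y))) (poisson bm bx (g_sec bx (\<lambda>_. (0, x))) (l3_fun bx l3)) \<alpha> p U
     = (\<Sum>i<?d. coord bx i y * (\<Sum>k<?d. lin_app \<alpha> (l3 x (bx ! i) (bx ! k)) * ?g k U))"
    using d2 by (simp add: g_sec_simps(1)[OF bx, of y] poisson_x[of _ _ y] odd_inf)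
  also have "\<dots> = (\<Sum>k<?d. \<Sum>i<?d. coord bx i y * lin_app \<alpha> (l3 x (bx ! i) (bx ! k)) * ?g k U)"
    by (subst sum.swap) (simp add: sum_distrib_left mult.assoc)
  also have "\<dots> = (\<Sum>k<?d. lin_app \<alpha> (l3 x y (bx ! k)) * ?g k U)"
    using sum_coord[OF bx lin_\<alpha>(2), of y] by (simp flip: sum_distrib_right)
  also have "\<dots> = g_sec bx (lin_sec (0, l3_at l3 x y)) \<alpha> p U"
  proof -
    have "lin_app (Lin (\<lambda>z. lin_app \<alpha> (lin_app (l3_at l3 x y) z))) = (\<lambda>z. lin_app \<alpha> (l3 x y z))"
      using linear_compose[OF lin3[of x y] lin_app_linear[of \<alpha>]]
      by (simp add: l3_at_def Lin_inverse lin3 o_def)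
    then show ?thesis
      by (simp add: lin_sec_def g_sec_simps(2)[OF bx] odd_xi_def)
  qed
  finally show "poisson bm bx (g_sec bx (\<lambda>_. (0, y))) (poisson bm bx (g_sec bx (\<lambda>_. (0, x))) (l3_fun bx l3)) \<alpha> p U
    = g_sec bx (lin_sec (0, l3_at l3 x y)) \<alpha> p U" .
qed

end

theory Submission
  imports Defs
begin

text \<open>\<open>{e, \<Theta>}\<close> is the contraction of \<open>\<Theta>\<close> with \<open>e\<close> plus a term with the derivatives of \<open>e\<close>; since
  \<open>\<Theta>\<close> is affine in the momentum, the derived brackets can be written down explicitly. On the
  functions \<open>m\<close> and the sections \<open>x + h\<close>, \<open>h \<in> Hom(\<gg>\<^sub>0, \<gg>\<^bsub>-1\<^esub>)\<close>, they are given by the map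
  \<open>D m = l\<^sub>1 m - l\<^sub>2(m, \<cdot>)\<close>, the \<open>\<gg>\<^bsub>-1\<^esub>\<close>-valued pairing \<open>(x + h, y + k) = h y + k x\<close> and a bilinear
  Dorfman bracket. The L-infinity identities of \<open>\<gg>\<close> give these data the algebraic properties of a
  Courant algebroid (Leibniz identity, invariance of the pairing, \<open>D\<close> of the pairing as the symmetric
  part of the bracket), and the Roytenberg-Weinstein argument, which uses nothing else, shows that the
  skew bracket and \<open>-T\<close> form a 2-term L-infinity algebra.

  Vector identities are tested against all linear functionals, which turns them into linear real
  arithmetic.\<close>

section \<open>Two-term L-infinity algebras from Courant-type data\<close>

text \<open>A nonzero difference \<open>a - b\<close> is an independent singleton, so the assignment
  of 1 to it extends to a linear functional that separates the two vectors.\<close>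

lemma lin_eqI: "a = b" if "\<And>f :: 'a::real_vector dual. f a = f b"
proof (rule ccontr)
  assume "a \<noteq> b"
  then have "independent {a - b}" by simp
  then obtain g :: "'a \<Rightarrow> real" where g: "linear g" "g (a - b) = 1"
    using linear_independent_extend[of "{a - b}" "\<lambda>_. 1"] by auto
  then show False using that[of "Lin g"] by (simp add: Lin_inverse linear_diff)
qed

lemmas bilinear_simps = bilinear_ladd bilinear_radd bilinear_lsub bilinear_rsub
  bilinear_lneg bilinear_rneg bilinear_lmul bilinear_rmul bilinear_lzero bilinear_rzero
lemmas linear_map_simps = linear_add linear_diff linear_neg linear_cmul linear_0

text \<open>A Courant algebroid without the product of functions: \<open>'v\<close> plays the
  functions, \<open>'w\<close> the sections, and the anchor is encoded by reading rho(a) v as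
  \<open>pr a (D v)\<close>. In this reading \<open>dm_pr\<close> is the invariance of the metric
  and \<open>pr_D_D\<close> says that rho vanishes on the image of \<open>D\<close>.\<close>

locale linear_courant =
  fixes D :: "'v::real_vector \<Rightarrow> 'w::real_vector"
    and pr :: "'w \<Rightarrow> 'w \<Rightarrow> 'v"
    and dm :: "'w \<Rightarrow> 'w \<Rightarrow> 'w"
  assumes linear_D: "linear D" and bilinear_pr: "bilinear pr" and bilinear_dm: "bilinear dm"
    and pr_sym: "pr a b = pr b a"
    and dm_sym: "dm a b + dm b a = D (pr a b)"
    and dm_D: "dm (D v) b = 0"
    and pr_D_D: "pr (D v) (D w) = 0"
    and dm_pr: "pr a (D (pr b c)) = pr (dm a b) c + pr b (dm a c)"
    and dm_dm: "dm a (dm b c) = dm (dm a b) c + dm b (dm a c)"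
begin

section \<open>The skew-symmetrized operations and their identities\<close>

definition br :: "'w \<Rightarrow> 'w \<Rightarrow> 'w" where "br a b = (1/2) *\<^sub>R (dm a b - dm b a)"

definition act :: "'w \<Rightarrow> 'v \<Rightarrow> 'v" where "act a v = (1/2) *\<^sub>R pr a (D v)"

definition tri :: "'w \<Rightarrow> 'w \<Rightarrow> 'w \<Rightarrow> 'v" where
  "tri a b c = - ((1/6) *\<^sub>R (pr (br a b) c + pr (br b c) a + pr (br c a) b))"

lemmas D_simps = linear_map_simps[OF linear_D]
lemmas pr_simps = bilinear_simps[OF bilinear_pr]
lemmas dm_simps = bilinear_simps[OF bilinear_dm]

lemma bilinear_br: "bilinear br"
  using bilinear_dm by (auto simp: bilinear_def linear_iff br_def algebra_simps)

lemma bilinear_act: "bilinear act"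
  by (auto simp: bilinear_def linear_iff act_def D_simps pr_simps algebra_simps)

lemmas br_simps = bilinear_simps[OF bilinear_br]

lemma linear_tri: "linear (\<lambda>a. tri a b c)"
  by (auto simp: linear_iff tri_def br_simps pr_simps algebra_simps)

text \<open>\<open>dm_sym\<close> identifies the symmetric part of \<open>dm\<close>; subtracting it
  leaves the skew part. The correction lies in the image of \<open>D\<close>, where
  \<open>dm_D\<close> and \<open>pr_D_D\<close> apply.\<close>

lemma br_alt: "br a b = dm a b - (1/2) *\<^sub>R D (pr a b)"
  by (simp add: br_def scaleR_right_diff_distrib scaleR_right_distrib flip: dm_sym)
    (simp flip: scaleR_left_distrib add: algebra_simps)

lemma dm_D_right: "dm a (D v) = D (pr a (D v))"
  using dm_sym[of a "D v"] by (simp add: dm_D)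

lemma br_D: "br a (D v) = (1/2) *\<^sub>R D (pr a (D v))" "br (D v) a = - ((1/2) *\<^sub>R D (pr a (D v)))"
  by (simp_all add: br_def dm_D dm_D_right)

text \<open>Invariance of the pairing at \<open>c = D v\<close>. In terms of rho: the anchor sends
  the bracket to the commutator.\<close>

lemma pr_dm_D: "pr (dm a b) (D v) = pr a (D (pr b (D v))) - pr b (D (pr a (D v)))"
  using dm_pr[of a b "D v"] by (simp add: dm_D_right algebra_simps)

lemma dm_br: "dm (br a b) c = dm (dm a b) c"
  by (simp add: br_alt dm_simps dm_D)

text \<open>Together with the next lemma, this brings every order of the arguments of
  \<open>pr (dm _ _) _\<close> to a single one, at the cost of terms
  \<open>pr _ (D (pr _ _))\<close>.\<close>

lemma pr_dm_swap23: "pr (dm a c) b = pr a (D (pr b c)) - pr (dm a b) c"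
  using dm_pr[of a b c] pr_sym[of "dm a c" b] by simp

lemma pr_dm_swap12: "pr (dm b a) c = pr c (D (pr a b)) - pr (dm a b) c"
  using arg_cong[OF dm_sym[of a b], of "\<lambda>w. pr w c"] pr_sym[of c]
  by (simp add: pr_simps algebra_simps)

text \<open>The three skew brackets in \<open>tri\<close> produce six terms of weight 1/12. Each
  reduces to \<open>pr (dm a b) c\<close> up to sign and derivative terms, and the signs agree after
  the reduction, which gives the weight 1/2.\<close>

lemma tri_alt:
  "tri a b c = - ((1/2) *\<^sub>R pr (dm a b) c)
     + (1/4) *\<^sub>R (pr a (D (pr b c)) - pr b (D (pr a c)) + pr c (D (pr a b)))"
proof (rule lin_eqI)
  fix f :: "'v dual"
  note f = linear_map_simps[OF lin_app_linear[of f]]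
  have s: "f (pr (dm x z) y) = f (pr x (D (pr y z))) - f (pr (dm x y) z)"
     "f (pr (dm y x) z) = f (pr z (D (pr x y))) - f (pr (dm x y) z)" for x y z
    using arg_cong[OF pr_dm_swap23[of x z y], of f] arg_cong[OF pr_dm_swap12[of y x z], of f]
    by (simp_all only: f)
  show "f (tri a b c) = f (- ((1/2) *\<^sub>R pr (dm a b) c)
     + (1/4) *\<^sub>R (pr a (D (pr b c)) - pr b (D (pr a c)) + pr c (D (pr a b))))"
    using s(1)[of a b c] s(1)[of b a c] s(1)[of c a b] s(2)[of a b c] s(2)[of a c b] s(2)[of b c a]
      pr_sym[of c b] pr_sym[of c a] pr_sym[of b a]
    by (simp add: tri_def br_def pr_simps f field_simps)
qed

lemma tri_skew: "tri a b c = - tri b a c" "tri a b c = - tri a c b"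
  by (simp_all add: tri_def br_def pr_simps algebra_simps)

text \<open>By \<open>pr_dm_D\<close> the leading term of \<open>tri_alt\<close> is -1/2 times the
  commutator of rho(a) and rho(b) on v. The derivative terms return 1/4 of it, the last of them
  being zero by \<open>pr_D_D\<close>.\<close>

lemma tri_D: "tri a b (D v) = (1/4) *\<^sub>R (pr b (D (pr a (D v))) - pr a (D (pr b (D v))))"
proof (rule lin_eqI)
  fix f :: "'v dual"
  note f = linear_map_simps[OF lin_app_linear[of f]]
  show "f (tri a b (D v)) = f ((1/4) *\<^sub>R (pr b (D (pr a (D v))) - pr a (D (pr b (D v)))))"
    by (simp add: tri_alt pr_dm_D f pr_D_D field_simps)
qed

text \<open>The Leibniz identity and the symmetric part of \<open>dm\<close> put the cyclic sum of
  \<open>dm (dm a b) c\<close> into the image of \<open>D\<close>. Passing from \<open>dm\<close> to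
  \<open>br\<close> adds further terms of this image, and the total is
  \<open>- D (tri a b c)\<close>.\<close>

theorem jacobiator:
  "br (br a b) c + br (br b c) a + br (br c a) b + D (tri a b c) = 0"
proof (rule lin_eqI)
  fix f :: "'w dual"
  note f = linear_map_simps[OF lin_app_linear[of f]]
  have 1: "f (dm (dm x y) z) = f (dm x (dm y z)) - f (dm y (dm x z))" for x y z
    by (simp add: dm_dm[of x y z] f)
  have 2: "f (dm x (dm y z)) + f (dm (dm y z) x) = f (D (pr x (dm y z)))" for x y z
    by (simp flip: dm_sym add: f)
  have 3: "f (dm (dm x y) z) + f (dm (dm y x) z) = 0" for x y z
  proof -
    have "dm (dm x y + dm y x) z = 0" by (simp only: dm_sym dm_D)
    then show ?thesis by (metis dm_simps(1) f(1,5))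
  qed
  have 4: "f (br (br x y) z) = f (dm (dm x y) z) - (1/2) * f (D (pr (br x y) z))" for x y z
    by (simp add: br_alt[of "br x y"] dm_br f)
  have 5: "2 * f (D (pr (br x y) z)) = f (D (pr (dm x y) z)) - f (D (pr (dm y x) z))" for x y z
    by (simp add: br_def pr_simps D_simps f)
  have 6: "6 * f (D (tri x y z)) = - (f (D (pr (br x y) z)) + f (D (pr (br y z) x)) + f (D (pr (br z x) y)))"
    for x y z
    by (simp add: tri_def D_simps f field_simps)
  have 7: "f (D (pr (dm x y) z)) = f (D (pr z (dm x y)))" for x y z
    by (simp add: pr_sym)
  show "f (br (br a b) c + br (br b c) a + br (br c a) b + D (tri a b c)) = f 0"
    unfolding f
    using 1[of a b c] 1[of b c a] 1[of c a b] 
      2[of a b c] 2[of b c a] 2[of c a b] 2[of a c b] 2[of b a c] 2[of c b a]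
      3[of a b c] 3[of b c a] 3[of c a b] 
      4[of a b c] 4[of b c a] 4[of c a b] 5[of a b c] 5[of b c a] 5[of c a b]
      6[of a b c] 
      7[of a b c] 7[of b c a] 7[of c a b] 7[of a c b] 7[of b a c] 7[of c b a]
    by linarith
qed

text \<open>A balance of weights of the commutator of rho(a) and rho(b): the factors 1/2 in
  \<open>act\<close> give 1/2 for the action of the bracket but only 1/4 for the commutator of the
  actions, and \<open>tri_D\<close> supplies the missing 1/4.\<close>

lemma act_jacobi: "act (br a b) v + (- act a (act b v)) + (- act b (- act a v)) + tri a b (D v) = 0"
proof (rule lin_eqI)
  fix f :: "'v dual"
  note f = linear_map_simps[OF lin_app_linear[of f]]
  show "f (act (br a b) v + (- act a (act b v)) + (- act b (- act a v)) + tri a b (D v)) = f 0"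
    by (simp add: act_def br_alt pr_simps D_simps tri_D pr_dm_D pr_D_D f field_simps)
qed

lemma tri_coherence:
  "tri (br a b) c d - tri (br a c) b d + tri (br a d) b c
     + tri (br b c) a d - tri (br b d) a c + tri (br c d) a b
   = (- act d (tri a b c)) - (- act c (tri a b d)) + (- act b (tri a c d)) - (- act a (tri b c d))"
proof (rule lin_eqI)
  fix f :: "'v dual"
  note f = linear_map_simps[OF lin_app_linear[of f]]
  \<comment> \<open>The quadrilinear terms that occur: \<open>P\<close> contains one bracket and one
    \<open>D\<close>, \<open>Q\<close> two brackets, \<open>S\<close> two occurrences of
    \<open>D\<close> and no bracket.\<close>
  define P where "P x y z w = f (pr x (D (pr (dm y z) w)))" for x y z w
  define Q where "Q x y z w = f (pr (dm x y) (dm z w))" for x y z w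
  define S where "S x y z w = f (pr x (D (pr y (D (pr z w)))))" for x y z w
  \<comment> \<open>The same term is evaluated twice: \<open>J1\<close> expands the inner bracket by
    the Leibniz identity, \<open>J2\<close> only moves z to the front by the symmetric part and
    invariance. Equating them therefore carries the content of the Leibniz identity.\<close>
  have J1: "f (pr (dm (dm x y) z) w) = P x y z w - Q y z x w - P y x z w + Q x z y w" for x y z w
  proof -
    have "pr (dm (dm x y) z) w = pr x (D (pr (dm y z) w)) - pr (dm y z) (dm x w)
       - (pr y (D (pr (dm x z) w)) - pr (dm x z) (dm y w))"
      using dm_pr[of x "dm y z" w] dm_pr[of y "dm x z" w] by (simp add: dm_dm[of x y z] pr_simps)
    then show ?thesis by (simp add: P_def Q_def f)
  qed
  have J2: "f (pr (dm (dm x y) z) w) = P w x y z - P z x y w + Q x y z w" for x y z w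
    using arg_cong[OF pr_dm_swap12[of "dm x y" z w], of f] arg_cong[OF dm_pr[of z "dm x y" w], of f]
    by (simp add: P_def Q_def f pr_sym)
  have dmR: "f (pr (dm x y) (D v)) = f (pr x (D (pr y (D v)))) - f (pr y (D (pr x (D v))))" for x y v
    by (simp add: pr_dm_D f)
  have L: "f (tri (br x y) z w) = - (1/2) * (P x y z w - Q y z x w - P y x z w + Q x z y w)
      + (1/4) * (S x y z w - S y x z w - P z x y w + P w x y z) - (1/8) * (S w z x y - S z w x y)"
    for x y z w
  proof -
    have "tri (br x y) z w = tri (dm x y) z w - (1/2) *\<^sub>R tri z w (D (pr x y))"
      unfolding br_alt[of x y] by (simp add: tri_def br_simps pr_simps algebra_simps)
    then have "f (tri (br x y) z w) = f (tri (dm x y) z w) - (1/2) * f (tri z w (D (pr x y)))"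
      by (simp add: f)
    then show ?thesis
      using J1[of x y z w] by (simp add: tri_alt[of "dm x y"] tri_D f dmR P_def S_def field_simps)
  qed
  have R: "f (act w (tri x y z)) = - (1/4) * P w x y z + (1/8) * (S w x y z - S w y x z + S w z x y)"
    for x y z w
    by (simp add: act_def tri_alt P_def S_def D_simps pr_simps f field_simps)
  \<comment> \<open>Symmetries under exchange of arguments, needed to compare the terms of
    \<open>L\<close>, \<open>R\<close>, \<open>J1\<close> and \<open>J2\<close>.\<close>
  have P: "P w x z y = S w x y z - P w x y z" "P w y x z = S w z x y - P w x y z" for x y z w
    by (simp_all add: P_def S_def pr_dm_swap23[of x z y] pr_dm_swap12[of y x z] D_simps pr_simps f)
  have Q: "Q x y z w + Q y x z w = S z w x y - S w z x y" "Q x y z w = Q z w x y" for x y z w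
  proof -
    show "Q x y z w = Q z w x y" for x y z w by (simp add: Q_def pr_sym)
    have "Q x y z w + Q y x z w = f (pr (dm z w) (D (pr x y)))"
      by (simp add: Q_def pr_sym[of "dm z w"] pr_simps f flip: dm_sym)
    then show "Q x y z w + Q y x z w = S z w x y - S w z x y" by (simp add: dmR S_def)
  qed
  have S: "S x y z w = S x y w z" for x y z w
    by (simp add: S_def pr_sym)
  show "f (tri (br a b) c d - tri (br a c) b d + tri (br a d) b c
     + tri (br b c) a d - tri (br b d) a c + tri (br c d) a b)
   = f ((- act d (tri a b c)) - (- act c (tri a b d)) + (- act b (tri a c d)) - (- act a (tri b c d)))"
    unfolding f L R
    \<comment> \<open>Up to the symmetries of \<open>P\<close>, \<open>Q\<close>, \<open>S\<close>, the claim is one instance of the Leibniz identity,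
      \<open>J1 = J2\<close>.\<close>
    using J1[of a b c d] J2[of a b c d]
      P(1)[of d a c b] P(2)[of d b a c] Q(1)[of a b c d] P(1)[of c a d b] P(2)[of c b a d] S[of a b d c]
      Q(1)[of a c b d] Q(2)[of a c b d] P(1)[of b a d c] Q(1)[of a d b c] S[of a d b c] P(1)[of b a c d]
      P(2)[of b d a c] Q(2)[of b a c d] P(1)[of c b d a] Q(1)[of b a d c] P(2)[of d c b a] Q(1)[of b c a d]
      Q(2)[of b c a d] P(1)[of a b d c] S[of b c d a] Q(1)[of b d a c] Q(2)[of b d c a] P(1)[of d c b a]
      P(2)[of d a c b] Q(1)[of c a b d] P(2)[of b a c d] Q(2)[of c a d b] Q(2)[of c b a d] P(1)[of a c d b]
      P(2)[of a b c d] P(1)[of b c a d] P(2)[of a d c b] S[of c d b a] P(2)[of c a d b] Q(1)[of d a c b]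
      Q(1)[of d b a c] P(1)[of a d c b] Q(1)[of d b c a] Q(1)[of d c b a] Q(2)[of d c b a] S[of d c b a]
    by argo
qed

lemma two_term_Linf:
  assumes "\<exists>B. finite B \<and> span B = (UNIV :: 'v set)"
    and "\<exists>B. finite B \<and> span B = (UNIV :: 'w set)"
  shows "two_term_Linf D br act tri"
proof (rule two_term_Linf.intro)
  show "br a b = - br b a" for a b by (simp add: br_def algebra_simps)
  show "D (act a v) = br a (D v)" for a v by (simp add: act_def br_D D_simps)
  show "act (D v) w = - act (D w) v" for v w by (simp add: act_def pr_D_D)
qed (fact assms linear_D bilinear_br bilinear_act linear_tri tri_skew jacobiator act_jacobi tri_coherence)+

end

section \<open>The Dorfman bracket on constant plus linear sections\<close>

lemma lin_app_eqI: "h = k" if "\<And>y. lin_app h y = lin_app k y"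
  using that by (metis lin_app_inverse ext)

lemma lin_app_zero [simp]: "lin_app 0 y = 0"
  and lin_app_minus [simp]: "lin_app (- h) y = - lin_app h y"
  and lin_app_diff [simp]: "lin_app (h - k) y = lin_app h y - lin_app k y"
  by (transfer; simp)+

context two_term_Linf
begin

definition Dl :: "'m \<Rightarrow> 'x \<times> ('x, 'm) lin" where
  "Dl m = (l1 m, - l21_at l21 m)"

definition pair :: "'x \<times> ('x, 'm) lin \<Rightarrow> 'x \<times> ('x, 'm) lin \<Rightarrow> 'm" where
  "pair u w = snd u (fst w) + snd w (fst u)"

text \<open>For u = (x, h) and w = (x', h'): after \<open>l3\<close> come the natural actions of x
  on h' and of x' on h, and the commutator of h and h' for the product h l1 h'. The summand
  \<open>l21 y (snd u (fst w))\<close> belongs, with \<open>l1 (snd u (fst w))\<close> in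
  \<open>dorf\<close>, to \<open>Dl (h x')\<close>; everything else is skew in u and w.\<close>

definition dorf_fun :: "'x \<times> ('x, 'm) lin \<Rightarrow> 'x \<times> ('x, 'm) lin \<Rightarrow> 'x \<Rightarrow> 'm" where
  "dorf_fun u w y = l3 (fst u) (fst w) y + snd u (l20 (fst w) y) - snd w (l20 (fst u) y)
     - l21 (fst w) (snd u y) + l21 (fst u) (snd w y) + l21 y (snd u (fst w))
     + snd u (l1 (snd w y)) - snd w (l1 (snd u y))"

definition dorf :: "'x \<times> ('x, 'm) lin \<Rightarrow> 'x \<times> ('x, 'm) lin \<Rightarrow> 'x \<times> ('x, 'm) lin" where
  "dorf u w = (l20 (fst u) (fst w) + l1 (snd u (fst w)), Lin (dorf_fun u w))"

lemmas l1_simps = linear_map_simps[OF linear_l1]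
lemmas l20_simps = bilinear_simps[OF bilinear_l20]
lemmas l21_simps = bilinear_simps[OF bilinear_l21]

lemma linear_l3': "linear (\<lambda>y. l3 x y z)" "linear (\<lambda>z. l3 x y z)"
proof -
  show 1: "linear (\<lambda>y. l3 x y z)" for x z
    using linear_compose_neg[OF linear_l3[of x z]] by (simp add: skew_l3(1)[symmetric])
  show "linear (\<lambda>z. l3 x y z)"
    using linear_compose_neg[OF 1[of x y]] by (simp add: skew_l3(2)[symmetric])
qed

lemmas l3_simps = linear_map_simps[OF linear_l3] linear_map_simps[OF linear_l3'(1)] linear_map_simps[OF linear_l3'(2)]
lemmas app_simps = linear_map_simps[OF lin_app_linear]
lemmas l_simps = l1_simps l20_simps l21_simps l3_simps app_simps

lemma l21_at_app: "lin_app (l21_at l21 m) y = - l21 y m"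
  unfolding l21_at_def by (subst Lin_inverse) (auto simp: linear_iff l_simps)

lemma l3_at_app: "lin_app (l3_at l3 x z) y = l3 x z y"
  unfolding l3_at_def by (subst Lin_inverse) (auto simp: linear_iff l_simps)

lemma linear_dorf_fun: "linear (dorf_fun u w)"
  by (simp add: linear_iff dorf_fun_def l_simps algebra_simps)

lemma dorf_app: "lin_app (snd (dorf u w)) y = dorf_fun u w y"
  by (simp add: dorf_def Lin_inverse linear_dorf_fun)

lemma fst_dorf: "fst (dorf u w) = l20 (fst u) (fst w) + l1 (snd u (fst w))"
  by (simp add: dorf_def)

lemma bilinear_dorf: "bilinear dorf"
  by (auto simp: bilinear_def linear_iff prod_eq_iff fst_dorf dorf_app dorf_fun_def l_simps
      algebra_simps intro!: lin_app_eqI)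

lemmas l20_l1 = l1_l2[symmetric]

lemma l20_l1': "l20 (l1 m) x = - l1 (l21 x m)"
  using skew_l20[of x "l1 m"] by (simp add: l1_l2)

lemma dorf_jacobi: "dorf a (dorf b c) = dorf (dorf a b) c + dorf b (dorf a c)"
proof -
  obtain x1 h1 x2 h2 x3 h3 where abc: "a = (x1, h1)" "b = (x2, h2)" "c = (x3, h3)"
    by (cases a; cases b; cases c)
  have "fst (dorf a (dorf b c)) = fst (dorf (dorf a b) c + dorf b (dorf a c))"
  proof (rule lin_eqI)
    fix f :: "'x dual"
    have "f (l20 (l20 x1 x2) x3 + l20 (l20 x2 x3) x1 + l20 (l20 x3 x1) x2 + l1 (l3 x1 x2 x3)) = 0"
      by (simp add: jacobi_000 l_simps)
    then show "f (fst (dorf a (dorf b c))) = f (fst (dorf (dorf a b) c + dorf b (dorf a c)))"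
      by (simp add: fst_dorf dorf_app dorf_fun_def abc l_simps l20_l1 l20_l1' skew_l20[of _ "l20 _ _"]
        skew_l20[of x3 x1])
  qed
  moreover have "snd (dorf a (dorf b c)) = snd (dorf (dorf a b) c + dorf b (dorf a c))"
  proof (rule lin_app_eqI, rule lin_eqI)
    fix y and f :: "'m dual"
    note J = arg_cong[OF jacobi_001, of f]
    note K = arg_cong[OF l2_l1, of f]
    note H = arg_cong[OF jacobi_000, of "\<lambda>z. f (lin_app h z)" for h]
    \<comment> \<open>Skew symmetry is oriented towards one order of the arguments, so that matching
      summands become equal terms.\<close>
    note sk = skew_l3(1)[of _ "l1 _"] skew_l3(2)[of _ _ "l1 _"] skew_l3(1)[of _ "l20 _ _"] skew_l3(2)[of _ _ "l20 _ _"]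
       skew_l20[of _ "l20 _ _"] skew_l20[of x2 x1] skew_l20[of x3 x1] skew_l20[of x3 x2]
       skew_l20[of y x1] skew_l20[of y x2] skew_l20[of y x3]
       skew_l3(1)[of x2 x1] skew_l3(1)[of x3 x1] skew_l3(1)[of x3 x2]
       skew_l3(1)[of y x1] skew_l3(1)[of y x2] skew_l3(1)[of y x3]
       skew_l3(2)[of _ x2 x1] skew_l3(2)[of _ x3 x1] skew_l3(2)[of _ x3 x2]
       skew_l3(2)[of _ y x1] skew_l3(2)[of _ y x2] skew_l3(2)[of _ y x3]
    show "f (lin_app (snd (dorf a (dorf b c))) y) = f (lin_app (snd (dorf (dorf a b) c + dorf b (dorf a c))) y)"
      \<comment> \<open>Sorted by the number of entries h1, h2, h3: no entry needs
        \<open>jacobi_0000\<close>; one entry needs \<open>jacobi_000\<close> inside h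
        (\<open>H\<close>) and \<open>jacobi_001\<close> at a value of h (\<open>J\<close>); two
        entries need \<open>l2_l1\<close> (\<open>K\<close>); three entries cancel, being the Jacobi
        identity of a commutator.\<close>
      using arg_cong[OF jacobi_0000[of x1 x2 x3 y], of f]
        H[of h1 x2 x3 y] H[of h2 x1 x3 y] H[of h3 x1 x2 y]
        J[of x1 x2 "h3 y"] J[of x1 x3 "h2 y"] J[of x2 x3 "h1 y"]
        J[of x1 y "h2 x3"] J[of x1 y "h3 x2"] J[of x2 y "h1 x3"] J[of x2 y "h3 x1"]
        J[of x3 y "h1 x2"] J[of x3 y "h2 x1"]
        K[of "h1 x2" "h2 y"] K[of "h1 y" "h2 x2"] K[of "h1 x3" "h2 y"] K[of "h1 y" "h2 x3"]
        K[of "h1 x2" "h3 y"] K[of "h1 y" "h3 x2"] K[of "h2 x1" "h3 y"] K[of "h2 y" "h3 x1"]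
      by (simp add: fst_dorf dorf_app dorf_fun_def abc l_simps l20_l1 l20_l1' sk)
  qed
  ultimately show ?thesis by (simp add: prod_eq_iff)
qed

text \<open>The skew part of \<open>dorf\<close> cancels; what remains is \<open>Dl\<close> of
  \<open>snd a (fst b)\<close> and of \<open>snd b (fst a)\<close>.\<close>

lemma dorf_sym: "dorf a b + dorf b a = Dl (pair a b)"
proof -
  have "snd (dorf a b + dorf b a) = snd (Dl (pair a b))"
    by (rule lin_app_eqI)
      (simp add: Dl_def dorf_app dorf_fun_def pair_def l21_at_app l_simps
        skew_l3(1)[of "fst b" "fst a"])
  then show ?thesis
    by (simp add: prod_eq_iff fst_dorf Dl_def pair_def l_simps skew_l20[of "fst b" "fst a"])
qed

lemma Dl_app: "fst (Dl m) = l1 m" "lin_app (snd (Dl m)) y = l21 y m"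
  by (simp_all add: Dl_def l21_at_app)

text \<open>The first component vanishes by the equivariance of \<open>l1\<close>. In the Hom
  component, \<open>jacobi_001\<close> handles \<open>fst b\<close> and \<open>l2_l1\<close> handles
  \<open>snd b\<close>.\<close>

lemma dorf_Dl: "dorf (Dl v) b = 0"
proof -
  have "snd (dorf (Dl v) b) = 0"
  proof (rule lin_app_eqI)
    fix y
    show "lin_app (snd (dorf (Dl v) b)) y = lin_app 0 y"
      using jacobi_001[of "fst b" y v] l2_l1[of v "snd b y"]
      by (simp add: Dl_app dorf_app dorf_fun_def l_simps l20_l1' skew_l3(1)[of "l1 v"]
        skew_l3(2)[of _ "l1 v"] algebra_simps)
  qed
  then show ?thesis
    by (simp add: prod_eq_iff fst_dorf Dl_app l_simps l20_l1')
qed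

lemma pair_Dl: "pair a (Dl v) = snd a (l1 v) + l21 (fst a) v"
  by (simp add: pair_def Dl_app)

text \<open>Isotropy of the image of \<open>Dl\<close> is exactly \<open>l2_l1\<close>. Invariance
  of the pairing is a cancellation that rests on the skew symmetry of \<open>l20\<close> and
  \<open>l3\<close>.\<close>

lemma linear_courant: "linear_courant Dl pair dorf"
proof (rule linear_courant.intro)
  show "linear Dl"
    by (auto simp: linear_iff Dl_def l_simps prod_eq_iff l21_at_app intro!: lin_app_eqI)
  show "bilinear pair"
    by (auto simp: bilinear_def linear_iff pair_def l_simps algebra_simps)
  show "pair a b = pair b a" for a b by (simp add: pair_def)
  show "pair (Dl v) (Dl w) = 0" for v w by (simp add: pair_Dl Dl_app l2_l1[of v w])
  show "pair a (Dl (pair b c)) = pair (dorf a b) c + pair b (dorf a c)" for a b c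
    by (simp add: pair_Dl) (simp add: pair_def fst_dorf dorf_app dorf_fun_def l_simps
        skew_l3(2)[of "fst a" "fst c" "fst b"] skew_l20[of "fst c" "fst b"])
qed (fact bilinear_dorf dorf_sym dorf_Dl dorf_jacobi)+

end

section \<open>Contractions and derived brackets\<close>

definition g_odd :: "'x::real_vector list \<Rightarrow> 'x dual \<times> 'x \<Rightarrow> grassmann" where
  "g_odd bx v U = odd_xi bx (fst v) U + odd_x bx (snd v) U"

definition canon :: "'x::real_vector dual \<times> 'x \<Rightarrow> 'x dual \<times> 'x \<Rightarrow> real" where
  "canon v w = fst v (snd w) + fst w (snd v)"

text \<open>For a constant section with value v this is the odd derivation {v, -}: each part of v
  differentiates along the generators dual to it, hence the crossed indices.\<close>

definition contr :: "'x::real_vector list \<Rightarrow> 'x dual \<times> 'x \<Rightarrow> grassmann \<Rightarrow> grassmann" where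
  "contr bx v G U = (\<Sum>i<length bx. coord bx i (snd v) * lder (length bx + i) G U + fst v (bx ! i) * lder i G U)"

lemma g_sec_g_odd: "g_sec bx e = (\<lambda>\<alpha> p. g_odd bx (e \<alpha>))"
  by (simp add: g_sec_def g_odd_def fun_eq_iff)

lemma g_odd_infinite: "infinite U \<Longrightarrow> g_odd bx v U = 0"
  by (simp add: g_odd_def odd_inf)

lemma g_odd_eq_0: "card U \<noteq> 1 \<Longrightarrow> g_odd bx v U = 0"
proof -
  assume "card U \<noteq> 1"
  then have "U \<noteq> {i}" for i by auto
  then show ?thesis by (simp add: g_odd_def odd_x_def odd_xi_def gen_def)
qed

lemma linear_g_odd: "linear (\<lambda>v. g_odd bx v U)"
  by (auto simp: linear_iff g_odd_def odd_x_def odd_xi_def algebra_simps sum.distrib sum_distrib_left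
      linear_map_simps[OF lin_app_linear])

lemma odd_xi_conv: "odd_xi bx \<xi> = g_odd bx (\<xi>, 0)"
  by (simp add: fun_eq_iff g_odd_def odd_x_def linear_map_simps[OF lin_app_linear])

lemma odd_x_conv: "odd_x bx x = g_odd bx (0, x)"
  by (simp add: fun_eq_iff g_odd_def odd_xi_def)

lemma sum_coord_real:
  assumes "is_basis bs"
  shows "(\<Sum>i<length bs. coord bs i v * lin_app \<xi> (bs ! i)) = \<xi> v"
    "(\<Sum>i<length bs. lin_app \<xi> (bs ! i) * coord bs i v) = \<xi> v"
  using sum_coord[OF assms lin_app_linear, of v \<xi>] by (simp_all add: mult.commute)

text \<open>The coefficients at the singletons \<open>{i}\<close> and \<open>{length bx + i}\<close>
  are the coordinates of \<open>snd v\<close> and \<open>fst v\<close>.\<close>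

lemma g_odd_inject:
  assumes "is_basis bx" "g_odd bx v = g_odd bx w"
  shows "v = w"
proof -
  have 1: "g_odd bx u {i} = coord bx i (snd u)" "g_odd bx u {length bx + i} = fst u (bx ! i)" 
    if "i < length bx" for i u
    using that by (simp_all add: g_odd_def odd_xi_def odd_x_def gen_def mult_delta_right)
  have 2: "coord bx i (snd v) = coord bx i (snd w)" "fst v (bx ! i) = fst w (bx ! i)"
    if "i < length bx" for i
    using that by (simp_all only: 1[OF that, symmetric] assms(2))
  have "f (snd v) = f (snd w)" for f :: "'a dual"
    using sum_coord_real(1)[OF assms(1), of "snd v" f] sum_coord_real(1)[OF assms(1), of "snd w" f] by (simp add: 2)
  moreover have "fst v y = fst w y" for y
    using sum_coord_real(1)[OF assms(1), of y "fst v"] sum_coord_real(1)[OF assms(1), of y "fst w"] by (simp add: 2)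
  ultimately show ?thesis
    by (intro prod_eqI) (rule lin_app_eqI, assumption, rule lin_eqI)
qed

lemma lder_add: "lder i (\<lambda>U. a U + b U) = (\<lambda>U. lder i a U + lder i b U)"
  by (simp add: lder_def fun_eq_iff algebra_simps)

lemma lder_minus: "lder i (\<lambda>U. - a U) = (\<lambda>U. - lder i a U)"
  by (simp add: lder_def fun_eq_iff)

lemma contr_simps:
  "contr bx v (\<lambda>U. a U + b U) = (\<lambda>U. contr bx v a U + contr bx v b U)"
  "contr bx v (\<lambda>U. a U - b U) = (\<lambda>U. contr bx v a U - contr bx v b U)"
  "contr bx v (\<lambda>U. - a U) = (\<lambda>U. - contr bx v a U)"
  "contr bx v (\<lambda>U. c * a U) = (\<lambda>U. c * contr bx v a U)"
  "contr bx v (\<lambda>U. \<Sum>j\<in>J. g j U) = (\<lambda>U. \<Sum>j\<in>J. contr bx v (g j) U)"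
  "contr bx v (\<lambda>U. c * gone U) = (\<lambda>_. 0)"
proof -
  show "contr bx v (\<lambda>U. \<Sum>j\<in>J. g j U) = (\<lambda>U. \<Sum>j\<in>J. contr bx v (g j) U)"
    unfolding contr_def fun_eq_iff by (subst sum.swap) (simp add: sum_distrib_left sum.distrib)
qed (simp_all add: contr_def fun_eq_iff lder_add lder_minus algebra_simps sum.distrib sum_distrib_left 
      sum_subtractf sum_negf)

lemma contr_infinite: "(\<And>U. infinite U \<Longrightarrow> G U = 0) \<Longrightarrow> infinite U \<Longrightarrow> contr bx v G U = 0"
  by (auto simp: contr_def lder_def intro!: sum.neutral)

lemma rder_add: "rder i (\<lambda>U. a U + b U) = (\<lambda>U. rder i a U + rder i b U)"
  by (simp add: rder_def fun_eq_iff algebra_simps)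

lemma der_g_odd:
  assumes "i < length bx"
  shows "rder i (g_odd bx v) = (\<lambda>U. coord bx i (snd v) * gone U)"
    "rder (length bx + i) (g_odd bx v) = (\<lambda>U. fst v (bx ! i) * gone U)"
    "lder i (g_odd bx v) = (\<lambda>U. coord bx i (snd v) * gone U)"
    "lder (length bx + i) (g_odd bx v) = (\<lambda>U. fst v (bx ! i) * gone U)"
  using assms unfolding g_odd_def[abs_def] lder_add rder_add by simp_all

lemma contr_g_odd:
  assumes "is_basis bx"
  shows "contr bx v (g_odd bx w) = (\<lambda>U. canon v w * gone U)"
proof
  fix U
  have "contr bx v (g_odd bx w) U = ((\<Sum>i<length bx. coord bx i (snd v) * fst w (bx ! i))
      + (\<Sum>i<length bx. fst v (bx ! i) * coord bx i (snd w))) * gone U"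
    by (simp add: contr_def der_g_odd sum.distrib distrib_right sum_distrib_right mult.assoc)
  then show "contr bx v (g_odd bx w) U = canon v w * gone U"
    by (simp only: sum_coord_real[OF assms] canon_def add.commute)
qed

lemma gmul_add: "gmul a (\<lambda>U. b U + c U) = (\<lambda>U. gmul a b U + gmul a c U)"
  by (rule ext) (simp only: gmul_def distrib_left sum.distrib)

text \<open>The graded Leibniz rule of an odd derivation. Coefficients at infinite index sets must
  vanish because \<open>gmul\<close> is 0 there.\<close>

lemma contr_gmul_gen:
  assumes "j < length bx" "\<And>U. infinite U \<Longrightarrow> b U = 0"
  shows "contr bx v (gmul (gen (length bx + j)) b) =
    (\<lambda>U. coord bx j (snd v) * b U - gmul (gen (length bx + j)) (contr bx v b) U)"
proof
  fix U
  let ?g = "gmul (gen (length bx + j))"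
  have 1: "?g (contr bx v b) U = (\<Sum>i<length bx. 
      coord bx i (snd v) * ?g (lder (length bx + i) b) U + fst v (bx ! i) * ?g (lder i b) U)"
    by (simp add: contr_def[abs_def] gmul_add)
  have 2: "(\<Sum>i<length bx. (if j = i then 1 else 0) * (coord bx i (snd v) * b U)) = coord bx j (snd v) * b U"
    using assms(1) by (simp only: sum_if_mult) simp
  have 3: "lder (length bx + i) (?g b) U = (if j = i then 1 else 0) * b U - ?g (lder (length bx + i) b) U" for i
    by (cases "finite U") (simp_all add: lder_gmul_gen assms(2))
  have 4: "lder i (?g b) U = - ?g (lder i b) U" if "i < length bx" for i
    using that by (simp add: lder_gmul_gen)
  have "contr bx v (?g b) U = (\<Sum>i<length bx. (if j = i then 1 else 0) * (coord bx i (snd v) * b U)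
     - (coord bx i (snd v) * ?g (lder (length bx + i) b) U + fst v (bx ! i) * ?g (lder i b) U))"
    unfolding contr_def
    by (rule sum.cong[OF refl]) (simp only: lessThan_iff 3 4 right_diff_distrib, simp add: mult.left_commute)
  then show "contr bx v (?g b) U = coord bx j (snd v) * b U - ?g (contr bx v b) U"
    by (simp only: sum_subtractf 1 2)
qed

lemma contr_gen:
  assumes "j < length bx"
  shows "contr bx v (gen (length bx + j)) = (\<lambda>U. coord bx j (snd v) * gone U)"
  using contr_gmul_gen[OF assms, of gone v] contr_simps(6)[of bx v 1]
  by (simp add: odd_inf)

lemma gmul_odd_xi: "gmul (odd_xi bx \<xi>) b = (\<lambda>U. \<Sum>i<length bx. \<xi> (bx ! i) * gmul (gen (length bx + i)) b U)"
proof
  fix U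
  show "gmul (odd_xi bx \<xi>) b U = (\<Sum>i<length bx. \<xi> (bx ! i) * gmul (gen (length bx + i)) b U)"
    unfolding gmul_def odd_xi_def
    by (simp add: sum_distrib_left sum_distrib_right algebra_simps) (subst sum.swap, simp)
qed

lemma contr_gmul_odd_xi:
  assumes "is_basis bx" "\<And>U. infinite U \<Longrightarrow> b U = 0"
  shows "contr bx v (gmul (odd_xi bx \<xi>) b) = (\<lambda>U. \<xi> (snd v) * b U - gmul (odd_xi bx \<xi>) (contr bx v b) U)"
proof
  fix U
  have "(\<Sum>i<length bx. \<xi> (bx ! i) * (coord bx i (snd v) * b U)) = \<xi> (snd v) * b U"
    using sum_coord_real(2)[OF assms(1), of \<xi> "snd v"] by (simp flip: mult.assoc sum_distrib_right)
  then show "contr bx v (gmul (odd_xi bx \<xi>) b) U = \<xi> (snd v) * b U - gmul (odd_xi bx \<xi>) (contr bx v b) U"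
    by (simp add: gmul_odd_xi contr_simps contr_gmul_gen assms(2) right_diff_distrib sum_subtractf)
qed

text \<open>Moving the i-th generator from one end of a monomial to the other passes the
  \<open>card U\<close> remaining generators.\<close>

lemma rder_lder:
  assumes "finite U"
  shows "rder i F U = (-1) ^ card U * lder i F U"
proof (cases "i \<in> U")
  case False
  let ?L = "{j \<in> U. j < i}" and ?R = "{j \<in> U. i < j}"
  have "?L \<union> ?R = U"
    using False by (auto, metis linorder_neqE_nat)
  moreover have "card (?L \<union> ?R) = card ?L + card ?R"
    using assms by (intro card_Un_disjoint) auto
  ultimately have "card U = card ?L + card ?R" by argo
  then have "(-1) ^ card U * ((-1) ^ card ?L * F (insert i U))
      = ((-1) ^ card ?L * (-1) ^ card ?L) * ((-1) ^ card ?R * F (insert i U))"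
    by (simp only: power_add mult_ac)
  also have "(-1 :: real) ^ card ?L * (-1) ^ card ?L = 1"
    by (simp flip: power_add)
  finally show ?thesis
    using False by (simp only: rder_def lder_def if_False mult_1)
qed (simp add: rder_def lder_def)

lemma dp_const: "dp n (\<lambda>\<alpha> _. F \<alpha>) = (\<lambda>_ _ _. 0)"
  by (simp add: dp_def)

text \<open>A section is free of the momentum and linear in the odd generators. So only its base
  derivatives enter the even part, and its odd derivatives are scalars, which makes the odd part a
  contraction.\<close>

lemma poisson_sec:
  assumes "finite U"
  shows "poisson bm bx (g_sec bx e) G \<alpha> p U =
    (\<Sum>a<length bm. gmul (dq (coord bm a) (g_sec bx e) \<alpha> p) (dp (bm ! a) G \<alpha> p) U) + contr bx (e \<alpha>) (G \<alpha> p) U"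
  using assms by (simp add: poisson_def g_sec_g_odd dp_const contr_def der_g_odd gmul_gone)

lemma poisson_sec_right:
  assumes "finite U"
  shows "poisson bm bx F (g_sec bx e) \<alpha> p U =
    - (\<Sum>a<length bm. gmul (dp (bm ! a) F \<alpha> p) (dq (coord bm a) (g_sec bx e) \<alpha> p) U)
    + (-1) ^ card U * contr bx (e \<alpha>) (F \<alpha> p) U"
  using assms
  by (simp add: poisson_def g_sec_g_odd dp_const contr_def der_g_odd gmul_gone' gmul_gone'[of _ 1, simplified] rder_lder sum_negf
      sum_distrib_left distrib_left mult.left_commute sum.distrib)

lemma poisson_fun_right:
  "poisson bm bx F (g_fun f) \<alpha> p U =
    - (\<Sum>a<length bm. gmul (dp (bm ! a) F \<alpha> p) (dq (coord bm a) (g_fun f) \<alpha> p) U)"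
proof -
  have "lder i (g_fun f \<alpha> p) = (\<lambda>_. 0)" for i by (simp add: g_fun_def)
  moreover have "dp n (g_fun f) = (\<lambda>_ _ _. 0)" for n by (simp add: g_fun_def dp_const)
  ultimately show ?thesis
    unfolding poisson_def by (simp only: gmul_0 sum.neutral_const diff_0 add_0_right add_0 sum_negf)
qed

lemma infinite_poisson:
  assumes "infinite U"
  shows "poisson bm bx F G \<alpha> p U = 0"
  unfolding poisson_def odd_inf(2)[OF assms] by simp

lemma contr_gmul_gen_odd:
  assumes "is_basis bx" "i < length bx" "j < length bx"
  defines "d \<equiv> length bx"
  shows "contr bx w (contr bx v (gmul (gen (d + i)) (gmul (gen (d + j)) (g_odd bx z)))) U
    = coord bx i (snd v) * (coord bx j (snd w) * g_odd bx z U - canon w z * gen (d + j) U)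
    - coord bx j (snd v) * (coord bx i (snd w) * g_odd bx z U - canon w z * gen (d + i) U)
    + canon v z * (coord bx i (snd w) * gen (d + j) U - coord bx j (snd w) * gen (d + i) U)"
  using assms(2,3) unfolding d_def
  by (simp add: contr_gmul_gen contr_gen contr_g_odd[OF assms(1)] contr_simps g_odd_infinite odd_inf)

lemma lin_sec_app:
  "lin_app (fst (lin_sec w \<alpha>)) y = \<alpha> (snd w y)" "snd (lin_sec w \<alpha>) = fst w"
  unfolding lin_sec_def case_prod_beta fst_conv snd_conv
  by (subst Lin_inverse) (simp_all add: linear_iff linear_map_simps[OF lin_app_linear])

lemma linear_lin_sec: "linear (\<lambda>w. lin_sec w \<alpha>)"
  by (auto simp: linear_iff prod_eq_iff lin_sec_app linear_map_simps[OF lin_app_linear] intro!: lin_app_eqI)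

section \<open>Derived brackets with \<open>Theta\<close>\<close>

context two_term_Linf
begin

text \<open>The form part of the result is the coadjoint action of \<open>snd v\<close> on
  \<open>fst w\<close> minus that of \<open>snd w\<close> on \<open>fst v\<close>.\<close>

lemma contr_contr_l20_fun:
  assumes bx: "is_basis bx"
  shows "contr bx w (contr bx v (l20_fun bx l20 \<alpha> p)) = g_odd bx (Lin (\<lambda>y. fst v (l20 (snd w) y) - fst w (l20 (snd v) y)), l20 (snd v) (snd w))"
proof
  fix U
  let ?d = "length bx"
  let ?u = "\<lambda>i. lin_app (coord bx i) (snd v)" and ?w = "\<lambda>i. lin_app (coord bx i) (snd w)"
  let ?z = "\<lambda>i j. l20 (bx ! i) (bx ! j)" and ?g = "\<lambda>i. gen (?d + i) U"
  \<comment> \<open>Three of the six terms of a doubly contracted monomial. By skew symmetry of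
    \<open>l20\<close> the other three are \<open>?t j i\<close>, so the double sum counts
    \<open>?t\<close> twice and the factor 1/2 disappears.\<close>
  let ?t = "\<lambda>i j. ?u i * ?w j * odd_x bx (?z i j) U - ?u i * fst w (?z i j) * ?g j + ?w i * fst v (?z i j) * ?g j"
  have can: "canon u (0, z) = fst u z" for u :: "'x dual \<times> 'x" and z
    by (simp add: canon_def)
  have sk: "odd_x bx (?z j i) U = - odd_x bx (?z i j) U" "lin_app \<xi> (?z j i) = - lin_app \<xi> (?z i j)" for \<xi> :: "'x dual" and i j
    by (subst skew_l20, simp add: linear_map_simps[OF linear_odd_x] app_simps)+
  have step: "contr bx w (contr bx v (gmul (gen (?d + i)) (gmul (gen (?d + j)) (odd_x bx (?z i j))))) U = ?t i j + ?t j i"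
    if "i < ?d" "j < ?d" for i j
    by (simp only: odd_x_conv contr_gmul_gen_odd[OF bx that] can)
      (simp add: odd_x_conv[symmetric] sk(1)[of j i] sk(2)[of _ j i] algebra_simps)
  have "contr bx w (contr bx v (l20_fun bx l20 \<alpha> p)) U = (1/2) * (\<Sum>i<?d. \<Sum>j<?d. 
     contr bx w (contr bx v (gmul (gen (?d + i)) (gmul (gen (?d + j)) (odd_x bx (?z i j))))) U)"
    unfolding l20_fun_def contr_simps ..
  also have "\<dots> = (1/2) * (\<Sum>i<?d. \<Sum>j<?d. ?t i j + ?t j i)"
    using step by simp
  also have "\<dots> = (\<Sum>i<?d. \<Sum>j<?d. ?t i j)"
    using sum.swap[of ?t "{..<?d}" "{..<?d}"] by (simp only: sum.distrib) argo
  also have "\<dots> = g_odd bx (Lin (\<lambda>y. fst v (l20 (snd w) y) - fst w (l20 (snd v) y)), l20 (snd v) (snd w)) U"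
  proof -
    have lin: "linear (\<lambda>x. odd_x bx (l20 x y) U)" "linear (\<lambda>y. odd_x bx (l20 x y) U)"
      "linear (\<lambda>x. lin_app \<xi> (l20 x y))" for x y and \<xi> :: "'x dual"
      by (simp_all add: linear_iff l20_simps app_simps linear_map_simps[OF linear_odd_x])
    have "(\<Sum>i<?d. \<Sum>j<?d. ?u i * ?w j * odd_x bx (?z i j) U)
        = (\<Sum>i<?d. ?u i * (\<Sum>j<?d. ?w j * odd_x bx (?z i j) U))"
      by (simp add: sum_distrib_left mult.assoc)
    also have "\<dots> = odd_x bx (l20 (snd v) (snd w)) U"
      using sum_coord[OF bx lin(2)] sum_coord[OF bx lin(1)] by simp
    finally have 1: "(\<Sum>i<?d. \<Sum>j<?d. ?u i * ?w j * odd_x bx (?z i j) U) = odd_x bx (l20 (snd v) (snd w)) U" .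
    have 2: "(\<Sum>i<?d. \<Sum>j<?d. lin_app (coord bx i) x * lin_app \<xi> (?z i j) * ?g j)
        = (\<Sum>j<?d. \<xi> (l20 x (bx ! j)) * ?g j)" for x and \<xi> :: "'x dual"
      using sum_coord[OF bx lin(3), of x \<xi>] by (subst sum.swap) (simp flip: sum_distrib_right)
    have "lin_app (Lin (\<lambda>y. fst v (l20 (snd w) y) - fst w (l20 (snd v) y)))
        = (\<lambda>y. fst v (l20 (snd w) y) - fst w (l20 (snd v) y))"
      by (rule Lin_inverse) (simp add: linear_iff l20_simps app_simps algebra_simps)
    then show ?thesis
      by (simp add: g_odd_def odd_xi_def sum.distrib sum_subtractf 1 2 left_diff_distrib)
  qed
  finally show "contr bx w (contr bx v (l20_fun bx l20 \<alpha> p)) U =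
    g_odd bx (Lin (\<lambda>y. fst v (l20 (snd w) y) - fst w (l20 (snd v) y)), l20 (snd v) (snd w)) U" .
qed

text \<open>Two contractions of a cubic monomial leave one generator in six ways. Skew symmetry of
  \<open>l3\<close> makes these the six permutations of the one term \<open>t\<close>, which absorbs
  the factor 1/6.\<close>

lemma contr_contr_l3_fun:
  assumes bx: "is_basis bx"
  shows "contr bx w (contr bx v (l3_fun bx l3 \<alpha> p)) = g_odd bx (Lin (\<lambda>y. \<alpha> (l3 (snd v) (snd w) y)), 0)"
proof
  fix U
  let ?d = "length bx"
  let ?u = "\<lambda>i. lin_app (coord bx i) (snd v)" and ?w = "\<lambda>i. lin_app (coord bx i) (snd w)"
  let ?A = "\<lambda>i j k. lin_app \<alpha> (l3 (bx ! i) (bx ! j) (bx ! k))" and ?g = "\<lambda>i. gen (?d + i) U"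
  define t where "t i j k = ?u i * (?w j * (?A i j k * ?g k))" for i j k
  have sk: "?A j i k = - ?A i j k" "?A i k j = - ?A i j k" for i j k
    by (subst skew_l3(1), simp add: app_simps) (subst skew_l3(2), simp add: app_simps)
  have step: "?A i j k * contr bx w (contr bx v
      (gmul (gen (?d + i)) (gmul (gen (?d + j)) (gen (?d + k))))) U
    = t i j k + t i k j + t j i k + t j k i + t k i j + t k j i"
    if "i < ?d" "j < ?d" "k < ?d" for i j k
    using that
    by (simp add: contr_gmul_gen contr_gen contr_simps odd_inf t_def sk(1)[of j i] sk(1)[of k i] sk(1)[of k j] 
        sk(2)[of i k j] sk(2)[of j k i])
      (simp add: algebra_simps)
  have "contr bx w (contr bx v (l3_fun bx l3 \<alpha> p)) U = (1/6) * (\<Sum>i<?d. \<Sum>j<?d. \<Sum>k<?d.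
     ?A i j k * contr bx w (contr bx v (gmul (gen (?d + i)) (gmul (gen (?d + j)) (gen (?d + k))))) U)"
    unfolding l3_fun_def contr_simps ..
  also have "\<dots> = (1/6) * (\<Sum>i<?d. \<Sum>j<?d. \<Sum>k<?d. t i j k + t i k j + t j i k + t j k i + t k i j + t k j i)"
    using step by simp
  also have "\<dots> = (\<Sum>i<?d. \<Sum>j<?d. \<Sum>k<?d. t i j k)"
  proof -
    let ?S = "\<lambda>h. (\<Sum>i<?d. \<Sum>j<?d. \<Sum>k<?d. h i j k :: real)"
    have s23: "?S (\<lambda>i j k. h i k j) = ?S h" for h :: "nat \<Rightarrow> nat \<Rightarrow> nat \<Rightarrow> real"
      by (rule sum.cong[OF refl], rule sum.swap)
    have s12: "?S (\<lambda>i j k. h j i k) = ?S h" for h :: "nat \<Rightarrow> nat \<Rightarrow> nat \<Rightarrow> real"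
      by (rule sum.swap)
    have "?S (\<lambda>i j k. t i k j) = ?S t" "?S (\<lambda>i j k. t j i k) = ?S t"
      "?S (\<lambda>i j k. t j k i) = ?S t" "?S (\<lambda>i j k. t k i j) = ?S t" "?S (\<lambda>i j k. t k j i) = ?S t"
      using s23[of t] s12[of t] s12[of "\<lambda>i j k. t i k j"] s23[of "\<lambda>i j k. t j i k"] s12[of "\<lambda>i j k. t k i j"]
      by (simp_all only:)
    then show ?thesis by (simp add: sum.distrib)
  qed
  also have "\<dots> = (\<Sum>k<?d. \<alpha> (l3 (snd v) (snd w) (bx ! k)) * ?g k)"
  proof -
    have lin: "linear (\<lambda>x. lin_app \<alpha> (l3 x y z))" "linear (\<lambda>y. lin_app \<alpha> (l3 x y z))" for x y z
      by (simp_all add: linear_iff l3_simps app_simps)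
    have "(\<Sum>i<?d. \<Sum>j<?d. \<Sum>k<?d. t i j k) = (\<Sum>i<?d. \<Sum>k<?d. \<Sum>j<?d. t i j k)"
      by (rule sum.cong[OF refl], rule sum.swap)
    also have "\<dots> = (\<Sum>k<?d. \<Sum>i<?d. \<Sum>j<?d. t i j k)"
      by (rule sum.swap)
    also have "\<dots> = (\<Sum>k<?d. (\<Sum>i<?d. ?u i * (\<Sum>j<?d. ?w j * ?A i j k)) * ?g k)"
      by (simp add: t_def sum_distrib_left sum_distrib_right mult.assoc)
    finally show ?thesis
      using sum_coord[OF bx lin(2)] sum_coord[OF bx lin(1)] by simp
  qed
  also have "\<dots> = g_odd bx (Lin (\<lambda>y. \<alpha> (l3 (snd v) (snd w) y)), 0) U"
  proof -
    have "lin_app (Lin (\<lambda>y. \<alpha> (l3 (snd v) (snd w) y))) = (\<lambda>y. \<alpha> (l3 (snd v) (snd w) y))"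
      by (rule Lin_inverse) (simp add: linear_iff l3_simps app_simps)
    then show ?thesis by (simp add: odd_xi_conv[symmetric] odd_xi_def)
  qed
  finally show "contr bx w (contr bx v (l3_fun bx l3 \<alpha> p)) U = g_odd bx (Lin (\<lambda>y. \<alpha> (l3 (snd v) (snd w) y)), 0) U" .
qed

text \<open>The summands \<open>l\<^sub>2\<^sup>0\<close> and \<open>l\<^sub>3\<close> do not depend on the momentum, which is set to 0.\<close>

definition cubic :: "'x list \<Rightarrow> 'm dual \<Rightarrow> grassmann" where
  "cubic bx \<alpha> U = l20_fun bx l20 \<alpha> 0 U + l3_fun bx l3 \<alpha> 0 U"

text \<open>The summands linear in the momentum, \<open>l1\<close> and \<open>l21\<close>, combine
  into the section of \<open>Dl p\<close>. This is the origin of \<open>Dl\<close>.\<close>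

lemma Theta_eq: "Theta bx l1 l20 l21 l3 \<alpha> p U = - (g_odd bx (lin_sec (Dl p) \<alpha>) U + cubic bx \<alpha> U)"
  by (simp add: Theta_def g_odd_def cubic_def l1_fun_def l21_fun_def l20_fun_def l3_fun_def
      odd_xi_def lin_sec_app Dl_app)

lemma deriv_affine': "deriv (\<lambda>t::real. c + t * d) 0 = d"
  by (intro DERIV_imp_deriv) (auto intro!: derivative_eq_intros)

lemmas odd_simps = linear_map_simps[OF linear_g_odd]
lemmas sec_simps = linear_map_simps[OF linear_lin_sec]

lemma linear_Dl: "linear Dl"
  using linear_courant by (rule linear_courant.linear_D)

lemmas Dl_simps = linear_map_simps[OF linear_Dl]

lemma dp_Theta: "dp n (Theta bx l1 l20 l21 l3) \<alpha> p = (\<lambda>U. - g_odd bx (lin_sec (Dl n) \<alpha>) U)"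
proof
  fix U
  have "Theta bx l1 l20 l21 l3 \<alpha> (p + t *\<^sub>R n) U
      = - (g_odd bx (lin_sec (Dl p) \<alpha>) U + cubic bx \<alpha> U) + t * (- g_odd bx (lin_sec (Dl n) \<alpha>) U)" for t
    by (simp add: Theta_eq odd_simps sec_simps Dl_simps algebra_simps)
  then show "dp n (Theta bx l1 l20 l21 l3) \<alpha> p U = - g_odd bx (lin_sec (Dl n) \<alpha>) U"
    unfolding dp_def by (simp only: deriv_affine')
qed

lemma cubic_infinite: "infinite U \<Longrightarrow> cubic bx \<alpha> U = 0"
  by (simp add: cubic_def l20_fun_def l3_fun_def odd_inf)

lemma poisson_sec_Theta:
  assumes bx: "is_basis bx"
  shows "poisson bm bx (g_sec bx e) (Theta bx l1 l20 l21 l3) \<alpha> p = (\<lambda>U.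
    - (\<Sum>a<length bm. gmul (dq (coord bm a) (g_sec bx e) \<alpha> p) (g_odd bx (lin_sec (Dl (bm ! a)) \<alpha>)) U)
    - canon (e \<alpha>) (lin_sec (Dl p) \<alpha>) * gone U - contr bx (e \<alpha>) (cubic bx \<alpha>) U)"
proof
  fix U
  have T: "Theta bx l1 l20 l21 l3 \<alpha> p = (\<lambda>U. - (g_odd bx (lin_sec (Dl p) \<alpha>) U + cubic bx \<alpha> U))"
    by (simp add: Theta_eq fun_eq_iff)
  have neg: "gmul a (\<lambda>U. - b U) U = - gmul a b U" for a b
    by (simp add: gmul_def sum_negf)
  show "poisson bm bx (g_sec bx e) (Theta bx l1 l20 l21 l3) \<alpha> p U =
    - (\<Sum>a<length bm. gmul (dq (coord bm a) (g_sec bx e) \<alpha> p) (g_odd bx (lin_sec (Dl (bm ! a)) \<alpha>)) U)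
    - canon (e \<alpha>) (lin_sec (Dl p) \<alpha>) * gone U - contr bx (e \<alpha>) (cubic bx \<alpha>) U"
  proof (cases "finite U")
    case True
    then show ?thesis
      by (simp add: poisson_sec dp_Theta T contr_simps contr_g_odd[OF bx] neg sum_negf)
  next
    case False
    then show ?thesis
      by (simp add: infinite_poisson odd_inf(2,4) contr_infinite cubic_infinite)
  qed
qed

text \<open>In \<open>poisson_sec_Theta\<close> the momentum matters only in the pairing with
  \<open>lin_sec (Dl p)\<close>, which is linear in p.\<close>

lemma dp_poisson_sec_Theta:
  assumes bx: "is_basis bx"
  shows "dp n (poisson bm bx (g_sec bx e) (Theta bx l1 l20 l21 l3)) \<alpha> p =
    (\<lambda>U. - canon (e \<alpha>) (lin_sec (Dl n) \<alpha>) * gone U)"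
proof
  fix U
  have dq: "dq \<beta> (g_sec bx e) \<alpha> p = dq \<beta> (g_sec bx e) \<alpha> 0" for \<beta> :: "'m dual" and p :: 'm
    by (simp add: dq_def g_sec_g_odd)
  have lin: "canon (e \<alpha>) (lin_sec (Dl (p + t *\<^sub>R n)) \<alpha>)
     = canon (e \<alpha>) (lin_sec (Dl p) \<alpha>) + t * canon (e \<alpha>) (lin_sec (Dl n) \<alpha>)" for t
    by (simp add: Dl_simps sec_simps canon_def app_simps algebra_simps)
  define K where "K = - (\<Sum>a<length bm. gmul (dq (coord bm a) (g_sec bx e) \<alpha> 0) (g_odd bx (lin_sec (Dl (bm ! a)) \<alpha>)) U)
    - canon (e \<alpha>) (lin_sec (Dl p) \<alpha>) * gone U - contr bx (e \<alpha>) (cubic bx \<alpha>) U"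
  have "poisson bm bx (g_sec bx e) (Theta bx l1 l20 l21 l3) \<alpha> (p + t *\<^sub>R n) U
     = K + t * (- canon (e \<alpha>) (lin_sec (Dl n) \<alpha>) * gone U)" for t
    unfolding poisson_sec_Theta[OF bx] lin dq[of _ "p + _"] K_def by (simp add: algebra_simps)
  then show "dp n (poisson bm bx (g_sec bx e) (Theta bx l1 l20 l21 l3)) \<alpha> p U
     = - canon (e \<alpha>) (lin_sec (Dl n) \<alpha>) * gone U"
    unfolding dp_def by (simp only: deriv_affine')
qed

text \<open>The minus sign of the momentum term of the Poisson bracket cancels that of
  \<open>Theta\<close>. The map \<open>e\<close> is arbitrary, as the characterization of
  \<open>Dop\<close> tests against all smooth sections.\<close>

lemma poisson_poisson_lin_fun:
  assumes bm: "is_basis bm" and bx: "is_basis bx"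
  shows "poisson bm bx (poisson bm bx (g_sec bx e) (Theta bx l1 l20 l21 l3)) (g_fun (lin_fun m))
    = g_fun (\<lambda>\<alpha>. canon (e \<alpha>) (lin_sec (Dl m) \<alpha>))"
proof (intro ext)
  fix \<alpha> :: "'m dual" and p :: 'm and U
  have 1: "dq \<beta> (g_fun (lin_fun m)) = (\<lambda>_ _ U. \<beta> m * gone U)" for \<beta> :: "'m dual"
    by (simp add: fun_eq_iff dq_def g_fun_def lin_fun_def deriv_affine)
  have lin: "linear (\<lambda>n. canon (e \<alpha>) (lin_sec (Dl n) \<alpha>))"
    by (simp add: linear_iff Dl_simps sec_simps canon_def app_simps algebra_simps)
  have "poisson bm bx (poisson bm bx (g_sec bx e) (Theta bx l1 l20 l21 l3)) (g_fun (lin_fun m)) \<alpha> p U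
    = (\<Sum>a<length bm. coord bm a m * canon (e \<alpha>) (lin_sec (Dl (bm ! a)) \<alpha>)) * gone U"
    unfolding poisson_fun_right dp_poisson_sec_Theta[OF bx] 1 gmul_gone sum_distrib_right
    by (auto simp add: odd_inf(4) sum_negf[symmetric] intro!: sum.cong)
  then show "poisson bm bx (poisson bm bx (g_sec bx e) (Theta bx l1 l20 l21 l3)) (g_fun (lin_fun m)) \<alpha> p U
      = g_fun (\<lambda>\<alpha>. canon (e \<alpha>) (lin_sec (Dl m) \<alpha>)) \<alpha> p U"
    using sum_coord[OF bm lin, of m] by (simp add: g_fun_def)
qed

lemma dq_lin_sec:
  "dq \<beta> (g_sec bx (lin_sec w)) \<alpha> p = odd_xi bx (Lin (\<lambda>y. \<beta> (snd w y)))"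
proof
  fix U
  have L: "lin_app (Lin (\<lambda>y. \<beta> (snd w y))) = (\<lambda>y. \<beta> (snd w y))"
    by (rule Lin_inverse) (simp add: linear_iff app_simps)
  have "lin_sec w (\<alpha> + t *\<^sub>R \<beta>) = lin_sec w \<alpha> + t *\<^sub>R (Lin (\<lambda>y. \<beta> (snd w y)), 0)" for t
    by (auto simp: prod_eq_iff lin_sec_app L intro!: lin_app_eqI)
  then have "g_odd bx (lin_sec w (\<alpha> + t *\<^sub>R \<beta>)) U
     = g_odd bx (lin_sec w \<alpha>) U + t * odd_xi bx (Lin (\<lambda>y. \<beta> (snd w y))) U" for t
    by (simp add: odd_simps odd_xi_conv del: scaleR_Pair)
  then show "dq \<beta> (g_sec bx (lin_sec w)) \<alpha> p U = odd_xi bx (Lin (\<lambda>y. \<beta> (snd w y))) U"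
    unfolding dq_def g_sec_g_odd by (simp only: deriv_affine')
qed

lemma gmul_odd_xi_gone: "gmul (odd_xi bx \<xi>) (\<lambda>U. c * gone U) = (\<lambda>U. c * odd_xi bx \<xi> U)"
  by (auto simp: fun_eq_iff gmul_gone'[of _ 1, simplified] odd_inf)

text \<open>Resums the base derivatives: expanding the values of \<open>h\<close> in the basis
  \<open>bm\<close> recovers the composition of \<open>\<phi>\<close> with \<open>h\<close>.\<close>

lemma sum_coord_odd_xi:
  assumes bm: "is_basis bm" and lin: "linear \<phi>"
  shows "(\<Sum>a<length bm. \<phi> (bm ! a) * odd_xi bx (Lin (\<lambda>y. coord bm a (lin_app h y))) U)
    = odd_xi bx (Lin (\<lambda>y. \<phi> (lin_app h y))) U"
proof -
  have 1: "lin_app (Lin (\<lambda>y. \<psi> (lin_app h y))) = (\<lambda>y. \<psi> (lin_app h y))" if "linear \<psi>" for \<psi> :: "'a \<Rightarrow> real"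
    by (rule Lin_inverse) (simp add: linear_iff app_simps linear_map_simps[OF that])
  have 2: "(\<Sum>a<length bm. \<phi> (bm ! a) * coord bm a m) = \<phi> m" for m
    using sum_coord[OF bm lin, of m] by (simp add: mult.commute)
  show ?thesis
    unfolding odd_xi_def 1[OF lin] 1[OF lin_app_linear] sum_distrib_left
    by (subst sum.swap) (simp add: 2 flip: mult.assoc sum_distrib_right)
qed

text \<open>Three sources make up \<open>dorf\<close>: the cubic part contracted with both sections,
  the base derivatives of \<open>lin_sec u\<close> against the momentum derivative of
  \<open>Theta\<close>, and the base derivatives of \<open>lin_sec w\<close> against that of
  \<open>?F\<close>.\<close>

lemma poisson_poisson_lin_sec:
  assumes bm: "is_basis bm" and bx: "is_basis bx"
  shows "poisson bm bx (poisson bm bx (g_sec bx (lin_sec u)) (Theta bx l1 l20 l21 l3)) (g_sec bx (lin_sec w))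
    = g_sec bx (lin_sec (dorf u w))"
proof (intro ext)
  fix \<alpha> :: "'m dual" and p :: 'm and U
  let ?F = "poisson bm bx (g_sec bx (lin_sec u)) (Theta bx l1 l20 l21 l3)"
  let ?e = "\<lambda>u. lin_sec u \<alpha>"
  let ?\<phi> = "\<lambda>u m. canon (?e u) (?e (Dl m))"
  \<comment> \<open>The doubly contracted \<open>cubic\<close>, with the contribution of
    \<open>l20\<close> followed by that of \<open>l3\<close>.\<close>
  define CC where "CC = (Lin (\<lambda>y. fst (?e u) (l20 (fst w) y) - fst (?e w) (l20 (fst u) y)), l20 (fst u) (fst w))
    + (Lin (\<lambda>y. \<alpha> (l3 (fst u) (fst w) y)), 0)"
  \<comment> \<open>Minus the contraction of \<open>?F\<close> with w; its first two summands come
    from the graded Leibniz rule applied to the derivative term of \<open>?F\<close>.\<close>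
  define V where "V = ?e (Dl (snd u (fst w))) - (Lin (\<lambda>y. ?\<phi> w (snd u y)), 0) + CC"
  have lin: "linear (?\<phi> u)" for u
    by (simp add: linear_iff Dl_simps sec_simps canon_def app_simps algebra_simps)
  show "poisson bm bx ?F (g_sec bx (lin_sec w)) \<alpha> p U = g_sec bx (lin_sec (dorf u w)) \<alpha> p U"
  proof (cases "finite U")
    case True
    have cc: "contr bx (?e w) (contr bx (?e u) (cubic bx \<alpha>)) U = g_odd bx CC U"
      by (simp add: cubic_def[abs_def] contr_simps contr_contr_l20_fun[OF bx] contr_contr_l3_fun[OF bx]
        CC_def odd_simps lin_sec_app del: add_Pair)
    have lin': "linear (\<lambda>m. g_odd bx (?e (Dl m)) U)"
      by (simp add: linear_iff odd_simps Dl_simps sec_simps)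
    have "contr bx (?e w) (?F \<alpha> p) U =
        - (\<Sum>a<length bm. coord bm a (snd u (fst w)) * g_odd bx (?e (Dl (bm ! a))) U)
        + (\<Sum>a<length bm. ?\<phi> w (bm ! a) * odd_xi bx (Lin (\<lambda>y. coord bm a (snd u y))) U)
        - g_odd bx CC U"
    proof -
      have L: "lin_app (Lin (\<lambda>y. coord bm a (snd u y))) x = coord bm a (snd u x)" for a x
        by (subst Lin_inverse) (simp_all add: linear_iff app_simps)
      show ?thesis
        unfolding poisson_sec_Theta[OF bx] dq_lin_sec contr_simps
        by (simp add: contr_gmul_odd_xi[OF bx] g_odd_infinite contr_g_odd[OF bx] cc L
          gmul_odd_xi_gone[of _ _ 1, simplified] contr_simps(6)[of _ _ 1, simplified]
          lin_sec_app sum_subtractf)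
    qed
    also have "\<dots> = - g_odd bx V U"
      using sum_coord[OF bm lin', of "snd u (fst w)"]
      by (simp add: sum_coord_odd_xi[OF bm lin] V_def odd_simps odd_xi_conv[symmetric] del: add_Pair diff_Pair)
    finally have 1: "contr bx (?e w) (?F \<alpha> p) U = - g_odd bx V U" .
    \<comment> \<open>\<open>g_odd\<close> is supported on singletons, where the sign from
      \<open>poisson_sec_right\<close> is -1.\<close>
    have 2: "(-1) ^ card U * g_odd bx v U = - g_odd bx v U" for v :: "'x dual \<times> 'x"
      by (cases "card U = 1") (simp_all add: g_odd_eq_0)
    have "poisson bm bx ?F (g_sec bx (lin_sec w)) \<alpha> p U
        = (\<Sum>a<length bm. ?\<phi> u (bm ! a) * odd_xi bx (Lin (\<lambda>y. coord bm a (snd w y))) U) + g_odd bx V U"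
      unfolding poisson_sec_right[OF True] dp_poisson_sec_Theta[OF bx] dq_lin_sec 1 mult_minus_right 2 gmul_gone
      using True by (simp add: sum_negf)
    also have "\<dots> = g_odd bx ((Lin (\<lambda>y. ?\<phi> u (snd w y)), 0) + V) U"
      by (simp add: sum_coord_odd_xi[OF bm lin] odd_simps odd_xi_conv[symmetric] del: add_Pair)
    also have "(Lin (\<lambda>y. ?\<phi> u (snd w y)), 0) + V = ?e (dorf u w)"
    proof -
      have L: "lin_app (Lin (\<lambda>y. ?\<phi> u (lin_app h y))) y = ?\<phi> u (lin_app h y)" for u y and h :: "('x, 'm) lin"
        by (subst Lin_inverse) (simp_all add: linear_iff app_simps linear_map_simps[OF lin])
      have L2: "lin_app (Lin (\<lambda>y. fst (?e u) (l20 (fst w) y) - fst (?e w) (l20 (fst u) y))) y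
          = fst (?e u) (l20 (fst w) y) - fst (?e w) (l20 (fst u) y)" for y
        by (subst Lin_inverse) (simp_all add: linear_iff app_simps l20_simps algebra_simps)
      have L3: "lin_app (Lin (\<lambda>y. \<alpha> (l3 (fst u) (fst w) y))) y = \<alpha> (l3 (fst u) (fst w) y)" for y
        by (subst Lin_inverse) (simp_all add: linear_iff app_simps l3_simps)
      show ?thesis
        by (auto simp: prod_eq_iff V_def CC_def lin_sec_app fst_dorf dorf_app dorf_fun_def canon_def
          L[unfolded canon_def lin_sec_app Dl_app] L2[unfolded lin_sec_app] L3
          app_simps Dl_app intro!: lin_app_eqI)
    qed
    finally show ?thesis by (simp add: g_sec_g_odd)
  qed (simp add: infinite_poisson g_sec_g_odd g_odd_infinite)
qed

end

section \<open>The restricted L-infinity algebra\<close>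

text \<open>Coinduction on the class of affine functions: a directional derivative is constant,
  hence affine with linear part evaluated at the vector 0.\<close>

lemma smooth_affine: "smooth (\<lambda>\<alpha>. c + lin_app \<alpha> m)"
proof -
  have "\<exists>c m. f = (\<lambda>\<alpha>. c + lin_app \<alpha> m) \<Longrightarrow> smooth f" for f :: "'m::real_vector dual \<Rightarrow> real"
  proof (coinduction arbitrary: f)
    case smooth
    then obtain c m where f: "f = (\<lambda>\<alpha>. c + lin_app \<alpha> m)" by blast
    have "continuous_on (Collect linear) (\<lambda>g :: 'm \<Rightarrow> real. c + g m)"
      by (intro continuous_intros continuous_on_subset[OF continuous_on_product_coordinates]) auto
    then have "continuous_on (Collect linear) (\<lambda>g. f (Lin g))"
      by (rule continuous_on_cong[THEN iffD1, rotated 2]) (auto simp: f Lin_inverse)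
    moreover have "((\<lambda>t. f (\<alpha> + t *\<^sub>R \<beta>)) has_real_derivative lin_app \<beta> m) (at 0)" for \<alpha> \<beta>
      unfolding f by (auto intro!: derivative_eq_intros)
    moreover have "(\<lambda>_. lin_app \<beta> m) = (\<lambda>\<alpha>. lin_app \<beta> m + lin_app \<alpha> 0)" for \<beta> :: "'m dual"
      by (simp add: linear_map_simps[OF lin_app_linear])
    ultimately show ?case
      by (intro exI[of _ f] exI[of _ "\<lambda>\<beta> _. lin_app \<beta> m"]) blast
  qed
  then show ?thesis by blast
qed

lemma smooth_const: "smooth (\<lambda>_ :: 'm::real_vector dual. c)"
  using smooth_affine[of c "0 :: 'm"] by (simp add: linear_map_simps[OF lin_app_linear])

lemma smooth_lin_fun: "smooth (lin_fun m)"
  using smooth_affine[of 0 m] by (simp add: lin_fun_def)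

lemma smooth_section_lin_sec: "smooth_section (lin_sec w)"
  using smooth_lin_fun by (auto simp: smooth_section_def lin_sec_app smooth_const lin_fun_def)

lemma smooth_section_const: "smooth_section (\<lambda>_ :: 'm::real_vector dual. v)"
  by (auto simp: smooth_section_def smooth_const)

lemma g_fun_inject: "g_fun f = g_fun h \<Longrightarrow> f = h"
  by (auto simp: g_fun_def gone_def fun_eq_iff dest: spec[of _ "{}"])

lemma tens_app: "lin_app (tens \<xi> m) x = \<xi> x *\<^sub>R m"
  by (simp add: tens.rep_eq)

text \<open>The Hom factor is spanned by the matrix units formed from the dual basis of
  \<open>bx\<close> and the basis \<open>bm\<close>.\<close>

lemma finite_span_prod_lin:
  assumes bx: "is_basis (bx :: 'x::real_vector list)" and bm: "is_basis (bm :: 'm::real_vector list)"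
  shows "\<exists>B. finite B \<and> span B = (UNIV :: ('x \<times> ('x, 'm) lin) set)"
proof (intro exI conjI)
  let ?S = "(\<lambda>b. (b, 0)) ` set bx"
  let ?T = "(\<lambda>(i, n). (0, tens (coord bx i) n)) ` ({..<length bx} \<times> set bm)"
  show "finite (?S \<union> ?T :: ('x \<times> ('x, 'm) lin) set)" by auto
  have "(x, h) \<in> span (?S \<union> ?T)" for x and h :: "('x, 'm) lin"
  proof -
    let ?x = "\<Sum>i<length bx. coord bx i x *\<^sub>R (bx ! i, 0 :: ('x, 'm) lin)"
    let ?h = "\<Sum>i<length bx. \<Sum>a<length bm. coord bm a (h (bx ! i)) *\<^sub>R (0 :: 'x, tens (coord bx i) (bm ! a))"
    have "?x = (x, 0)"
      using sum_coord[OF bx, of "\<lambda>x. (x, 0 :: ('x, 'm) lin)"] by (simp add: linear_iff)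
    moreover have "?h = (0, h)"
    proof -
      have tens: "linear (\<lambda>n. (0 :: 'x, tens \<xi> n))" for \<xi> :: "'x dual"
        by (auto simp: linear_iff tens_app algebra_simps intro!: lin_app_eqI)
      have "lin_app (\<Sum>i\<in>I. g i) y = (\<Sum>i\<in>I. lin_app (g i) y)" for I y and g :: "nat \<Rightarrow> ('x, 'm) lin"
        by (induction I rule: infinite_finite_induct) simp_all
      then have "(\<Sum>i<length bx. tens (coord bx i) (h (bx ! i))) = h"
        using sum_coord[OF bx lin_app_linear[of h]] by (intro lin_app_eqI) (simp add: tens_app)
      moreover have "(\<Sum>i\<in>I. (0 :: 'x, g i)) = (0, \<Sum>i\<in>I. g i)" for I and g :: "nat \<Rightarrow> ('x, 'm) lin"
        by (induction I rule: infinite_finite_induct) (simp_all add: zero_prod_def)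
      ultimately show ?thesis
        by (simp only: sum_coord[OF bm tens])
    qed
    moreover have "?x + ?h \<in> span (?S \<union> ?T)"
      by (intro span_add span_sum span_scale span_base) auto
    ultimately show ?thesis by simp
  qed
  then show "span (?S \<union> ?T) = (UNIV :: ('x \<times> ('x, 'm) lin) set)" by auto
qed

section \<open>Restriction to linear functions and constant plus linear sections\<close>

context two_term_Linf
begin

lemma assoc_courant_simps:
  "base_funs (assoc_courant bm bx l1 l20 l21 l3) = Collect smooth"
  "sections (assoc_courant bm bx l1 l20 l21 l3) = Collect smooth_section"
  "pairing (assoc_courant bm bx l1 l20 l21 l3) e1 e2 = (\<lambda>\<alpha>. canon (e1 \<alpha>) (e2 \<alpha>))"
  by (simp_all add: assoc_courant_def Let_def pairing_def canon_def case_prod_beta)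

lemma canon_lin_sec: "canon (lin_sec u \<alpha>) (lin_sec w \<alpha>) = \<alpha> (pair u w)"
  by (simp add: canon_def pair_def lin_sec_app app_simps)

lemma anchor_lin_fun:
  assumes "is_basis bm" "is_basis bx"
  shows "anchor (assoc_courant bm bx l1 l20 l21 l3) e (lin_fun m) = (\<lambda>\<alpha>. canon (e \<alpha>) (lin_sec (Dl m) \<alpha>))"
  unfolding assoc_courant_def Let_def courant.simps poisson_poisson_lin_fun[OF assms]
  by (rule the_equality) (auto dest: g_fun_inject)

lemma dorfman_lin_sec:
  assumes "is_basis bm" "is_basis bx"
  shows "dorfman (assoc_courant bm bx l1 l20 l21 l3) (lin_sec u) (lin_sec w) = lin_sec (dorf u w)"
  unfolding assoc_courant_def Let_def courant.simps poisson_poisson_lin_sec[OF assms]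
proof (rule the_equality)
  fix e :: "'m dual \<Rightarrow> 'x dual \<times> 'x" assume "g_sec bx e = g_sec bx (lin_sec (dorf u w))"
  then show "e = lin_sec (dorf u w)"
    by (intro ext g_odd_inject[OF assms(2)]) (auto simp: g_sec_g_odd dest: fun_cong)
qed simp

lemma canon_nondegenerate:
  assumes "\<And>v. canon v a = canon v b"
  shows "a = b"
proof (intro prod_eqI)
  show "fst a = fst b"
    using assms[of "(0, y)" for y] by (intro lin_app_eqI) (simp add: canon_def)
  show "snd a = snd b"
    using assms[of "(\<xi>, 0)" for \<xi>] by (intro lin_eqI[of "snd a"]) (simp add: canon_def app_simps)
qed

text \<open>Uniqueness in the description of \<open>Dop\<close>: constant sections are smooth, and
  pairing with them determines a section at every point.\<close>

lemma Dop_lin_fun: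
  assumes "is_basis bm" "is_basis bx"
  shows "Dop (assoc_courant bm bx l1 l20 l21 l3) (lin_fun m) = lin_sec (Dl m)"
  unfolding Dop_def assoc_courant_simps anchor_lin_fun[OF assms]
proof (rule the_equality)
  fix s assume s: "s \<in> Collect smooth_section \<and>
    (\<forall>e\<in>Collect smooth_section. (\<lambda>\<alpha>. canon (e \<alpha>) (s \<alpha>)) = (\<lambda>\<alpha>. canon (e \<alpha>) (lin_sec (Dl m) \<alpha>)))"
  show "s = lin_sec (Dl m)"
  proof (rule ext, rule canon_nondegenerate)
    fix \<alpha> v
    have "(\<lambda>\<alpha>. canon v (s \<alpha>)) = (\<lambda>\<alpha>. canon v (lin_sec (Dl m) \<alpha>))"
      using bspec[OF conjunct2[OF s], of "\<lambda>_. v"] smooth_section_const[of v] by simp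
    then show "canon v (s \<alpha>) = canon v (lin_sec (Dl m) \<alpha>)" by (rule fun_cong)
  qed
qed (simp add: smooth_section_lin_sec)

abbreviation "t20 \<equiv> linear_courant.br dorf"
abbreviation "t21 \<equiv> linear_courant.act Dl pair"
abbreviation "t3 \<equiv> linear_courant.tri pair dorf"

lemmas t20_def = linear_courant.br_def[OF linear_courant]
lemmas t21_def = linear_courant.act_def[OF linear_courant]
lemmas t3_def = linear_courant.tri_def[OF linear_courant]

text \<open>Under \<open>lin_fun\<close> and \<open>lin_sec\<close> the maps \<open>Dl\<close>,
  \<open>pair\<close> and \<open>dorf\<close> become \<open>Dop\<close>, the pairing and the Dorfman
  bracket of E, and the operations on both sides are built from these by the same formulas.\<close>

lemma is_restriction_assoc_courant:
  assumes "is_basis bm" "is_basis bx"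
  shows "is_restriction (assoc_courant bm bx l1 l20 l21 l3) lin_fun lin_sec Dl t20 t21 t3"
proof -
  have "inj (lin_fun :: 'm \<Rightarrow> _)"
  proof (rule injI, rule lin_eqI)
    fix m n and f :: "'m dual" assume "(lin_fun m :: 'm dual \<Rightarrow> real) = lin_fun n"
    from fun_cong[OF this, of f] show "f m = f n" by (simp add: lin_fun_def)
  qed
  moreover have "inj (lin_sec :: 'x \<times> ('x, 'm) lin \<Rightarrow> _)"
  proof (rule injI)
    fix u w :: "'x \<times> ('x, 'm) lin" assume eq: "lin_sec u = lin_sec w"
    have "fst u = fst w"
      using arg_cong[OF fun_cong[OF eq, of 0], of snd] by (simp add: lin_sec_app)
    moreover have "snd u = snd w"
    proof (rule lin_app_eqI, rule lin_eqI)
      fix f :: "'m dual" and y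
      show "f (snd u y) = f (snd w y)"
        using arg_cong[OF fun_cong[OF eq, of f], of "\<lambda>v. lin_app (fst v) y"] by (simp add: lin_sec_app)
    qed
    ultimately show "u = w" by (rule prod_eqI)
  qed
  moreover have br: "courant_bracket (assoc_courant bm bx l1 l20 l21 l3) (lin_sec u) (lin_sec w) = lin_sec (t20 u w)" for u w
    by (simp add: courant_bracket_def dorfman_lin_sec[OF assms] t20_def sec_simps fun_eq_iff)
  moreover have "CA_l21 (assoc_courant bm bx l1 l20 l21 l3) (lin_sec w) (lin_fun v) = lin_fun (t21 w v)" for w v
    unfolding CA_l21_def Dop_lin_fun[OF assms] assoc_courant_simps canon_lin_sec
    by (simp add: t21_def lin_fun_def app_simps)
  moreover have "CA_l3 (assoc_courant bm bx l1 l20 l21 l3) (lin_sec u) (lin_sec v) (lin_sec w) = lin_fun (t3 u v w)"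
    for u v w
    unfolding CA_l3_def Tfun_def br assoc_courant_simps canon_lin_sec
    by (simp add: t3_def lin_fun_def app_simps)
  moreover have "linear (\<lambda>v. lin_fun v p)" for p :: "'m dual"
    by (simp add: lin_fun_def lin_app_linear)
  ultimately show ?thesis
    unfolding is_restriction_def assoc_courant_simps CA_l1_def CA_l20_def
    using smooth_lin_fun smooth_section_lin_sec linear_lin_sec Dop_lin_fun[OF assms]
    by (intro conjI allI) (auto simp: lin_fun_def)
qed

section \<open>Explicit formulas for the restricted operations\<close>

lemma t20_app:
  "fst (t20 u w) = (1/2) *\<^sub>R (fst (dorf u w) - fst (dorf w u))"
  "lin_app (snd (t20 u w)) y = (1/2) *\<^sub>R (dorf_fun u w y - dorf_fun w u y)"
  by (simp_all add: t20_def dorf_app)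

lemma l20_dual_app: "lin_app (l20_dual l20 x \<xi>) y = - \<xi> (l20 x y)"
  unfolding l20_dual_def by (subst Lin_inverse) (simp_all add: linear_iff l20_simps app_simps)

lemma l1_dual_app: "lin_app (l1_dual l1 \<xi>) m = - \<xi> (l1 m)"
  unfolding l1_dual_def by (subst Lin_inverse) (simp_all add: linear_iff l1_simps app_simps)

lemma prod_lin_eqI:
  fixes u w :: "'x \<times> ('x, 'm) lin"
  assumes "\<And>f :: 'x dual. f (fst u) = f (fst w)" "\<And>(f :: 'm dual) y. f (snd u y) = f (snd w y)"
  shows "u = w"
  using assms by (intro prod_eqI lin_app_eqI) (rule lin_eqI, assumption)+

lemma t20_xx: "t20 (x, 0) (y, 0) = (l20 x y, l3_at l3 x y)"
  by (rule prod_lin_eqI)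
    (simp_all add: t20_app fst_dorf dorf_fun_def l3_at_app l_simps skew_l20[of y x] skew_l3(1)[of y x])

text \<open>The first two summands are the Dorfman bracket. The last is half of \<open>Dl\<close> of
  the pairing \<open>\<xi> x *\<^sub>R m\<close>, subtracted as in \<open>br_alt\<close>.\<close>

lemma t20_x_tens: "t20 (x, 0) (0, tens \<xi> m) =
    (0, tens \<xi> (l21 x m)) + (0, tens (l20_dual l20 x \<xi>) m) - ((1/2) * \<xi> x) *\<^sub>R (l1 m, - l21_at l21 m)"
  by (rule prod_lin_eqI)
    (simp_all add: t20_app fst_dorf dorf_fun_def tens_app l20_dual_app l21_at_app l_simps field_simps)

text \<open>Both arguments have no constant part, so their pairing is 0 and the bracket is the
  commutator for the product h l1 k.\<close>

lemma t20_tens_tens: "t20 (0, tens \<xi> m) (0, tens \<eta> n) =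
    (0, l1_dual l1 \<eta> m *\<^sub>R tens \<xi> n - l1_dual l1 \<xi> n *\<^sub>R tens \<eta> m)"
  by (rule prod_lin_eqI)
    (simp_all add: t20_app fst_dorf dorf_fun_def tens_app l1_dual_app l_simps field_simps)

lemma t21_x_tens: "t21 (x, tens \<xi> m) n = (1/2) *\<^sub>R l21 x n + ((1/2) * \<xi> (l1 n)) *\<^sub>R m"
  by (simp add: t21_def pair_Dl tens_app algebra_simps)

text \<open>Each \<open>l3\<close> and \<open>l20\<close> term arises once from every cyclic summand
  of \<open>tri\<close>, so its coefficient is 3/6.\<close>

lemma t3_tens:
  fixes \<xi>1 \<xi>2 \<xi>3 :: "'x dual"
  shows "t3 (x1, tens \<xi>1 m1) (x2, tens \<xi>2 m2) (x3, tens \<xi>3 m3) =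
    - (1/2) *\<^sub>R l3 x1 x2 x3
    - (1/2) *\<^sub>R (\<xi>3 (l20 x1 x2) *\<^sub>R m3
           + \<xi>1 (l20 x2 x3) *\<^sub>R m1
           + \<xi>2 (l20 x3 x1) *\<^sub>R m2)
    - (1/4) *\<^sub>R (((\<xi>1 x2 * \<xi>3 (l1 m1)) *\<^sub>R m3 - (\<xi>2 x1 * \<xi>3 (l1 m2)) *\<^sub>R m3)
           + ((\<xi>2 x3 * \<xi>1 (l1 m2)) *\<^sub>R m1 - (\<xi>3 x2 * \<xi>1 (l1 m3)) *\<^sub>R m1)
           + ((\<xi>3 x1 * \<xi>2 (l1 m3)) *\<^sub>R m2 - (\<xi>1 x3 * \<xi>2 (l1 m1)) *\<^sub>R m2))
    - (1/4) *\<^sub>R ((\<xi>2 x3 *\<^sub>R l21 x1 m2 - \<xi>3 x2 *\<^sub>R l21 x1 m3)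
           + (\<xi>3 x1 *\<^sub>R l21 x2 m3 - \<xi>1 x3 *\<^sub>R l21 x2 m1)
           + (\<xi>1 x2 *\<^sub>R l21 x3 m1 - \<xi>2 x1 *\<^sub>R l21 x3 m2))" (is "?l = ?r")
proof (rule lin_eqI)
  fix f :: "'m dual"
  have "6 * f ?l = - (f (pair (t20 (x1, tens \<xi>1 m1) (x2, tens \<xi>2 m2)) (x3, tens \<xi>3 m3))
    + f (pair (t20 (x2, tens \<xi>2 m2) (x3, tens \<xi>3 m3)) (x1, tens \<xi>1 m1))
    + f (pair (t20 (x3, tens \<xi>3 m3) (x1, tens \<xi>1 m1)) (x2, tens \<xi>2 m2)))"
    by (simp add: t3_def app_simps field_simps)
  also have "\<dots> = 6 * f ?r"
    by (simp add: pair_def t20_app fst_dorf dorf_fun_def tens_app l_simps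
        skew_l20[of x2 x1] skew_l20[of x3 x1] skew_l20[of x3 x2]
        skew_l3(1)[of x2 x1] skew_l3(1)[of x3 x1] skew_l3(1)[of x3 x2]
        skew_l3(2)[of _ x2 x1] skew_l3(2)[of _ x3 x1] skew_l3(2)[of _ x3 x2])
      (simp add: field_simps)
  finally show "f ?l = f ?r" by simp
qed

lemma t3_x_tens:
  fixes x :: "nat \<Rightarrow> 'x" and \<xi> :: "nat \<Rightarrow> 'x dual" and m :: "nat \<Rightarrow> 'm"
  shows "t3 (x 1, tens (\<xi> 1) (m 1)) (x 2, tens (\<xi> 2) (m 2)) (x 3, tens (\<xi> 3) (m 3)) =
         - (1/2) *\<^sub>R l3 (x 1) (x 2) (x 3)
         - (1/2) *\<^sub>R cyc (\<lambda>i j k. \<xi> k (l20 (x i) (x j)) *\<^sub>R m k)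
         - (1/4) *\<^sub>R cyc (\<lambda>i j k. (\<xi> i (x j) * \<xi> k (l1 (m i))) *\<^sub>R m k
                                - (\<xi> j (x i) * \<xi> k (l1 (m j))) *\<^sub>R m k)
         - (1/4) *\<^sub>R cyc (\<lambda>i j k. \<xi> j (x k) *\<^sub>R l21 (x i) (m j)
                                - \<xi> k (x j) *\<^sub>R l21 (x i) (m k))" 
  unfolding cyc_def by (rule t3_tens)

end

theorem theorem4p6:
  fixes l1 :: "'m::real_vector \<Rightarrow> 'x::real_vector"
    and l20 :: "'x \<Rightarrow> 'x \<Rightarrow> 'x"
    and l21 :: "'x \<Rightarrow> 'm \<Rightarrow> 'm"
    and l3 :: "'x \<Rightarrow> 'x \<Rightarrow> 'x \<Rightarrow> 'm"
    and bm :: "'m list" and bx :: "'x list"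
    and E :: "('m dual, 'x dual \<times> 'x) courant"
  assumes "two_term_Linf l1 l20 l21 l3"
    and "is_basis bm" and "is_basis bx"
    and "E = assoc_courant bm bx l1 l20 l21 l3"
  shows "\<exists>(t1 :: 'm \<Rightarrow> 'x \<times> ('x, 'm) lin) t20 t21 t3.
    is_restriction E lin_fun lin_sec t1 t20 t21 t3 \<and>
    two_term_Linf t1 t20 t21 t3 \<and>
    (\<forall>m. t1 m = (l1 m, - l21_at l21 m)) \<and>
    (\<forall>x y. t20 (x, 0) (y, 0) = (l20 x y, l3_at l3 x y)) \<and>
    (\<forall>x \<xi> m. t20 (x, 0) (0, tens \<xi> m) =
       (0, tens \<xi> (l21 x m)) + (0, tens (l20_dual l20 x \<xi>) m)
         - ((1/2) * \<xi> x) *\<^sub>R (l1 m, - l21_at l21 m)) \<and>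
    (\<forall>\<xi> m \<eta> n. t20 (0, tens \<xi> m) (0, tens \<eta> n) =
       (0, l1_dual l1 \<eta> m *\<^sub>R tens \<xi> n - l1_dual l1 \<xi> n *\<^sub>R tens \<eta> m)) \<and>
    (\<forall>x \<xi> m n. t21 (x, tens \<xi> m) n = (1/2) *\<^sub>R l21 x n + ((1/2) * \<xi> (l1 n)) *\<^sub>R m) \<and>
    (\<forall>(x :: nat \<Rightarrow> 'x) (\<xi> :: nat \<Rightarrow> 'x dual) (m :: nat \<Rightarrow> 'm).
       t3 (x 1, tens (\<xi> 1) (m 1)) (x 2, tens (\<xi> 2) (m 2)) (x 3, tens (\<xi> 3) (m 3)) =
         - (1/2) *\<^sub>R l3 (x 1) (x 2) (x 3)
         - (1/2) *\<^sub>R cyc (\<lambda>i j k. \<xi> k (l20 (x i) (x j)) *\<^sub>R m k)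
         - (1/4) *\<^sub>R cyc (\<lambda>i j k. (\<xi> i (x j) * \<xi> k (l1 (m i))) *\<^sub>R m k
                                - (\<xi> j (x i) * \<xi> k (l1 (m j))) *\<^sub>R m k)
         - (1/4) *\<^sub>R cyc (\<lambda>i j k. \<xi> j (x k) *\<^sub>R l21 (x i) (m j)
                                - \<xi> k (x j) *\<^sub>R l21 (x i) (m k)))"
proof -
  interpret two_term_Linf l1 l20 l21 l3 by fact
  have "is_restriction E lin_fun lin_sec Dl t20 t21 t3"
    unfolding assms(4) by (rule is_restriction_assoc_courant) fact+
  moreover have "two_term_Linf Dl t20 t21 t3"
    using linear_courant fin_dim_m finite_span_prod_lin[OF assms(3,2)] by (rule linear_courant.two_term_Linf)
  moreover have "Dl m = (l1 m, - l21_at l21 m)" for m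
    by (simp add: Dl_def)
  ultimately show ?thesis
    by (intro exI[of _ Dl] exI[of _ t20] exI[of _ t21] exI[of _ t3] conjI allI
      t20_xx t20_x_tens t20_tens_tens t21_x_tens t3_x_tens)
qed

end
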